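(* Let $n \ge 5000$ be an integer. Every $n$-vertex $F_5$-free $3$-graph $\mathcal{H}$ with $\delta(\mathcal{H}) > \frac{4n^2}{45}$ is $3$-partite.
   Context: A $3$-graph is a collection $\mathcal{H}$ of $3$-element subsets (edges) of a finite vertex set $V(\mathcal{H})$. The degree of a vertex $v$ is the number of edges containing $v$, and $\delta(\mathcal{H})$ is the minimum degree. $F_5$ is the $3$-graph on $\{a,b,c,d,e\}$ with edge set $\{abc, abd, cde\}$; $\mathcal{H}$ is $F_5$-free if it contains no subgraph isomorphic to $F_5$. $\mathcal{H}$ is $3$-partite if $V(\mathcal{H})$ can be partitioned into three sets such that every edge of $\mathcal{H}$ contains exactly one vertex from each set. *)

theory Defs
  imports Complex_Main
begin

definition three_graph :: "'a set \<Rightarrow> 'a set set \<Rightarrow> bool" where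
  "three_graph V E \<longleftrightarrow> finite V \<and> (\<forall>e\<in>E. e \<subseteq> V \<and> card e = 3)"

definition degree :: "'a set set \<Rightarrow> 'a \<Rightarrow> nat" where
  "degree E v = card {e \<in> E. v \<in> e}"

text \<open>Meaningful only for a finite nonempty vertex set.\<close>

definition min_degree :: "'a set \<Rightarrow> 'a set set \<Rightarrow> nat" where
  "min_degree V E = Min (degree E ` V)"

definition subgraph :: "'a set \<Rightarrow> 'a set set \<Rightarrow> 'a set \<Rightarrow> 'a set set \<Rightarrow> bool" where
  "subgraph V' E' V E \<longleftrightarrow> three_graph V' E' \<and> V' \<subseteq> V \<and> E' \<subseteq> E"

definition isomorphic :: "'a set \<Rightarrow> 'a set set \<Rightarrow> 'b set \<Rightarrow> 'b set set \<Rightarrow> bool" where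
  "isomorphic V E W F \<longleftrightarrow> (\<exists>f. bij_betw f V W \<and> (`) f ` E = F)"

text \<open>The vertices a, b, c, d, e of the graph with edges abc, abd, cde are numbered 0, 1, 2, 3, 4.\<close>

definition F5_verts :: "nat set" where
  "F5_verts = {0, 1, 2, 3, 4}"

definition F5_edges :: "nat set set" where
  "F5_edges = {{0, 1, 2}, {0, 1, 3}, {2, 3, 4}}"

definition F5_free :: "'a set \<Rightarrow> 'a set set \<Rightarrow> bool" where
  "F5_free V E \<longleftrightarrow>
    \<not> (\<exists>V' E'. subgraph V' E' V E \<and> isomorphic F5_verts F5_edges V' E')"

definition three_partite :: "'a set \<Rightarrow> 'a set set \<Rightarrow> bool" where
  "three_partite V E \<longleftrightarrow>
    (\<exists>A B C. A \<union> B \<union> C = V \<and> A \<inter> B = {} \<and> A \<inter> C = {} \<and> B \<inter> C = {} \<and>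
      (\<forall>e\<in>E. card (e \<inter> A) = 1 \<and> card (e \<inter> B) = 1 \<and> card (e \<inter> C) = 1))"

end

theory Submission
  imports Defs
begin

text \<open>
  Join two vertices when they lie in a common edge or when their links are disjoint. By
  \<open>F\<^sub>5\<close>-freeness the links of joined vertices share at most \<open>O(n)\<close> pairs, so the links of a clique
  are almost disjoint, and Turan's theorem forbids a \<open>K\<^sub>4\<close>. Non-adjacent vertices have a common
  link edge, hence this graph is \<open>K\<^sub>4\<close>-saturated, and Mantel's theorem in the links gives
  minimum degree above \<open>0.596n\<close>.

  If non-adjacency is an equivalence relation, its (at most three) classes are the parts. Otherwise
  two diamonds sharing a vertex, or a wheel over a 5-cycle, appear; by degree counting there is a
  wheel in both cases. An upper bound on the number of edges of a triangle-free graph that has large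
  minimum degree and a 5-cycle shows that hubs have degree above \<open>0.66n\<close> while rim vertices have
  degree below \<open>0.64n\<close>. So a hub is never a rim vertex, which forces the non-neighbours \<open>A\<close> of a hub
  to be independent. Every edge of the hypergraph then has exactly one vertex in \<open>A\<close>, and the same
  bound applied outside \<open>A\<close> contradicts the degree condition, with equality for
  \<open>|A| = n/3\<close> and a balanced blow-up of the 5-cycle.
\<close>

section \<open>Turan's theorem\<close>

text \<open>Ordered pairs, so every edge of a symmetric graph counts twice. Links are counted the
  same way later, which lets the two be compared without factors of 2.\<close>

definition edge_pairs :: "('a \<Rightarrow> 'a \<Rightarrow> bool) \<Rightarrow> 'a set \<Rightarrow> ('a \<times> 'a) set" where
  "edge_pairs E W = {(x, y). x \<in> W \<and> y \<in> W \<and> E x y}"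

definition nbrs :: "('a \<Rightarrow> 'a \<Rightarrow> bool) \<Rightarrow> 'a set \<Rightarrow> 'a \<Rightarrow> 'a set" where
  "nbrs E W v = {w \<in> W. E v w}"

definition has_clique :: "('a \<Rightarrow> 'a \<Rightarrow> bool) \<Rightarrow> 'a set \<Rightarrow> nat \<Rightarrow> bool" where
  "has_clique E W r \<longleftrightarrow> (\<exists>K\<subseteq>W. card K = r \<and> (\<forall>x\<in>K. \<forall>y\<in>K. x \<noteq> y \<longrightarrow> E x y))"

lemma finite_nbrs [simp]: "finite W \<Longrightarrow> finite (nbrs E W v)"
  by (simp add: nbrs_def)

lemma finite_edge_pairs [simp]: "finite W \<Longrightarrow> finite (edge_pairs E W)"
  by (rule finite_subset[of _ "W \<times> W"]) (auto simp: edge_pairs_def)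

lemma card_edge_pairs: "finite W \<Longrightarrow> card (edge_pairs E W) = (\<Sum>v\<in>W. card (nbrs E W v))"
proof -
  assume "finite W"
  moreover have "edge_pairs E W = Sigma W (nbrs E W)"
    by (auto simp: edge_pairs_def nbrs_def)
  ultimately show ?thesis by simp
qed

text \<open>A pair not contained in \<open>N\<close> has an end in \<open>W - N\<close>. Each such
  end accounts for at most \<open>d\<close> pairs, and the factor 2 covers both orders.\<close>

lemma edge_pairs_le_nbrs:
  assumes "finite W" "symp E" "\<And>w. w \<in> W \<Longrightarrow> card (nbrs E W w) \<le> d" "N \<subseteq> W"
  shows "card (edge_pairs E W) \<le> card (edge_pairs E N) + 2 * (card (W - N) * d)"
proof -
  let ?S = "Sigma (W - N) (nbrs E W)"
  have fin: "finite ?S" "finite (edge_pairs E N)"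
    using assms(1) finite_subset[OF assms(4,1)] by auto
  have "edge_pairs E W \<subseteq> edge_pairs E N \<union> (?S \<union> prod.swap ` ?S)"
    using assms(2) by (force simp: edge_pairs_def nbrs_def image_iff symp_def)
  then have "card (edge_pairs E W) \<le> card (edge_pairs E N \<union> (?S \<union> prod.swap ` ?S))"
    using fin by (intro card_mono) auto
  also have "\<dots> \<le> card (edge_pairs E N) + (card ?S + card (prod.swap ` ?S))"
    by (meson card_Un_le add_left_mono order_trans)
  also have "card (prod.swap ` ?S) \<le> card ?S"
    using fin by (intro card_image_le)
  also have "card ?S = (\<Sum>w\<in>W - N. card (nbrs E W w))"
    using assms(1) by simp
  also have "\<dots> \<le> card (W - N) * d"
    using sum_bounded_above[of "W - N" "\<lambda>w. card (nbrs E W w)" d] assms(3) by simp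
  finally show ?thesis by simp
qed

text \<open>Induction on \<open>r\<close> through the neighbourhood \<open>N\<close> of a vertex of
  maximum degree: \<open>N\<close> contains no clique one size smaller, since the vertex would
  extend it, and every vertex outside \<open>N\<close> has degree at most
  \<open>card N\<close>.\<close>

theorem turan_edge_pairs:
  assumes "finite W" "symp E" "irreflp E" "\<not> has_clique E W (Suc r)" "r \<ge> 1"
  shows "real r * real (card (edge_pairs E W)) \<le> (real r - 1) * (real (card W))\<^sup>2"
  using assms(5,1,4)
proof (induction r arbitrary: W rule: dec_induct)
  case base
  have "edge_pairs E W = {}"
  proof (rule ccontr)
    assume "edge_pairs E W \<noteq> {}"
    then obtain x y where "x \<in> W" "y \<in> W" "E x y" by (auto simp: edge_pairs_def)
    moreover have "x \<noteq> y" using \<open>E x y\<close> assms(3) by (auto simp: irreflp_def)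
    ultimately have "has_clique E W (Suc 1)"
      using assms(2) unfolding has_clique_def symp_def
      by (intro exI[of _ "{x, y}"]) auto
    then show False using base by simp
  qed
  then show ?case by simp
next
  case (step r)
  show ?case
  proof (cases "W = {}")
    case True
    then show ?thesis by (simp add: edge_pairs_def)
  next
    case False
    define f where "f = (\<lambda>w. card (nbrs E W w))"
    have "Max (f ` W) \<in> f ` W" using step.prems(1) False by (intro Max_in) auto
    then obtain v where "v \<in> W" "f v = Max (f ` W)" by (auto simp: image_iff)
    then have v: "v \<in> W" "\<And>w. w \<in> W \<Longrightarrow> f w \<le> f v"
      using step.prems(1) by auto
    define N where "N = nbrs E W v"
    have NW: "N \<subseteq> W" by (auto simp: N_def nbrs_def)
    have "\<not> has_clique E N (Suc r)"
    proof
      assume "has_clique E N (Suc r)"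
      then obtain K where K: "K \<subseteq> N" "card K = Suc r" "\<And>x y. x \<in> K \<Longrightarrow> y \<in> K \<Longrightarrow> x \<noteq> y \<Longrightarrow> E x y"
        unfolding has_clique_def by blast
      have vK: "v \<notin> K" using K(1) assms(3) by (auto simp: N_def nbrs_def irreflp_def)
      have "finite K" using K(2) by (simp add: card_ge_0_finite)
      then have "card (insert v K) = Suc (Suc r)" using K(2) vK by simp
      moreover have "insert v K \<subseteq> W" using K(1) NW v(1) by auto
      moreover have "\<forall>x\<in>insert v K. \<forall>y\<in>insert v K. x \<noteq> y \<longrightarrow> E x y"
        using K(1,3) assms(2) by (auto simp: N_def nbrs_def symp_def)
      ultimately have "has_clique E W (Suc (Suc r))"
        unfolding has_clique_def by blast
      then show False using step.prems(2) by simp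
    qed
    moreover have "finite N" using step.prems(1) NW by (rule finite_subset[rotated])
    ultimately have IH: "real r * real (card (edge_pairs E N)) \<le> (real r - 1) * (real (card N))\<^sup>2"
      using step.IH by blast
    define n d where "n = real (card W)" and "d = real (card N)"
    have "card (edge_pairs E W) \<le> card (edge_pairs E N) + 2 * (card (W - N) * card N)"
      using edge_pairs_le_nbrs[OF step.prems(1) assms(2) _ NW, of "card N"] v(2)
      by (simp add: f_def N_def)
    also have "card (W - N) = card W - card N"
      using NW step.prems(1) by (meson card_Diff_subset finite_subset)
    finally have "real (card (edge_pairs E W))
        \<le> real (card (edge_pairs E N) + 2 * ((card W - card N) * card N))"
      by (simp only: of_nat_le_iff)
    then have le: "real (card (edge_pairs E W)) \<le> real (card (edge_pairs E N)) + 2 * ((n - d) * d)"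
      using card_mono[OF step.prems(1) NW] by (simp add: n_def d_def of_nat_diff)
    define p where "p = real (card (edge_pairs E N))"
    have rp: "real r * p \<le> (real r - 1) * d\<^sup>2" and r0: "real r > 0"
      using IH step.hyps by (auto simp: p_def d_def)
    have "real r * ((real r + 1) * real (card (edge_pairs E W)))
        \<le> real r * ((real r + 1) * (p + 2 * ((n - d) * d)))"
      using le by (intro mult_left_mono) (auto simp: p_def)
    also have "\<dots> = (real r + 1) * (real r * p) + 2 * real r * (real r + 1) * ((n - d) * d)"
      by (simp add: algebra_simps)
    also have "\<dots> \<le> (real r + 1) * ((real r - 1) * d\<^sup>2) + 2 * real r * (real r + 1) * ((n - d) * d)"
      using rp by (intro add_right_mono mult_left_mono) auto
    \<comment> \<open>The loss is a perfect square, zero exactly at the balanced degree d =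
      rn/(r+1).\<close>
    also have "\<dots> = real r * (real r * n\<^sup>2) - (real r * n - (real r + 1) * d)\<^sup>2"
      by (simp add: algebra_simps power2_eq_square)
    also have "\<dots> \<le> real r * (real r * n\<^sup>2)" by simp
    finally have "(real r + 1) * real (card (edge_pairs E W)) \<le> real r * n\<^sup>2"
      using r0 by (simp only: mult_le_cancel_left_pos)
    then show ?thesis by (simp add: n_def add.commute)
  qed
qed

section \<open>Triangle-free graphs with a 5-cycle\<close>

text \<open>The computation behind \<open>pentagon_edge_bound\<close>. For a 5-cycle,
  \<open>di\<close> is the degree of its i-th vertex, \<open>pi\<close> the number of common
  neighbours of that vertex's two cycle neighbours, \<open>z\<close> the number of vertices outside
  these five classes, and \<open>zi\<close> how many of those are adjacent to the i-th vertex. The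
  left side bounds a degree sum; \<open>K\<close> measures how far \<open>m\<close> may exceed
  \<open>3 * D\<close>.\<close>

lemma pentagon_class_arith:
  fixes p1 p2 p3 p4 p5 d1 d2 d3 d4 d5 z1 z2 z3 z4 z5 z m D K S :: real
  assumes m: "m = p1 + p2 + p3 + p4 + p5 + z"
    and d: "d1 = p5 + p2 + z1" "d2 = p1 + p3 + z2" "d3 = p2 + p4 + z3"
      "d4 = p3 + p5 + z4" "d5 = p4 + p1 + z5"
    and z: "z1 \<ge> 0" "z2 \<ge> 0" "z3 \<ge> 0" "z4 \<ge> 0" "z5 \<ge> 0" "z1 + z2 + z3 + z4 + z5 \<le> z"
    and D: "d1 \<ge> D" "d2 \<ge> D" "d3 \<ge> D" "d4 \<ge> D" "d5 \<ge> D" "D \<ge> 0" "2 * D \<le> m"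
    and K: "m \<le> 3 * D + K" "K \<ge> 0"
    and S: "S = d1 + d2 + d3 + d4 + d5"
  shows "p1 * d1 + p2 * d2 + p3 * d3 + p4 * d4 + p5 * d5 + z * (S - 4 * D)
    \<le> 2 * m\<^sup>2 - 8 * m * D + 10 * D\<^sup>2 + K\<^sup>2 / 4"
proof -
  define y where "y = z1 + z2 + z3 + z4 + z5"
  have y: "0 \<le> y" "y \<le> z" using z by (auto simp: y_def)
  have Sy: "S = 2 * m - 2 * z + y" using m d S by (simp add: y_def)
  have p: "p1 = m - z - d3 - d4 + z3 + z4" "p2 = m - z - d4 - d5 + z4 + z5"
    "p3 = m - z - d5 - d1 + z5 + z1" "p4 = m - z - d1 - d2 + z1 + z2"
    "p5 = m - z - d2 - d3 + z2 + z3"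
    using m d by simp_all
  define Q where "Q = d1 * d3 + d2 * d4 + d3 * d5 + d4 * d1 + d5 * d2"
  \<comment> \<open>All degrees are at least \<open>D\<close>, so products over non-consecutive
    pairs of the cycle bound \<open>Q\<close> below by a function linear in
    \<open>S\<close>.\<close>
  have "0 \<le> (d1 - D) * (d3 - D) + (d2 - D) * (d4 - D) + (d3 - D) * (d5 - D)
      + (d4 - D) * (d1 - D) + (d5 - D) * (d2 - D)"
    using D by (intro add_nonneg_nonneg mult_nonneg_nonneg) auto
  also have "\<dots> = Q - 2 * D * S + 5 * D\<^sup>2"
    by (simp add: Q_def S algebra_simps power2_eq_square)
  finally have Q: "2 * Q \<ge> 4 * D * S - 10 * D\<^sup>2" by simp
  have "p1 * d1 + p2 * d2 + p3 * d3 + p4 * d4 + p5 * d5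
    = (m - z) * S - 2 * Q + (z1 * (d3 + d4) + z2 * (d4 + d5) + z3 * (d5 + d1)
        + z4 * (d1 + d2) + z5 * (d2 + d3))"
    unfolding p Q_def S by (simp add: algebra_simps)
  also have "z1 * (d3 + d4) + z2 * (d4 + d5) + z3 * (d5 + d1) + z4 * (d1 + d2) + z5 * (d2 + d3)
    \<le> z1 * (S - 3 * D) + z2 * (S - 3 * D) + z3 * (S - 3 * D) + z4 * (S - 3 * D) + z5 * (S - 3 * D)"
    using z D S by (intro add_mono mult_left_mono) auto
  also have "\<dots> = y * (S - 3 * D)" by (simp add: y_def algebra_simps)
  finally have "p1 * d1 + p2 * d2 + p3 * d3 + p4 * d4 + p5 * d5 + z * (S - 4 * D)
    \<le> (m - z) * S - (4 * D * S - 10 * D\<^sup>2) + y * (S - 3 * D) + z * (S - 4 * D)"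
    using Q by simp
  also have "\<dots> = 2 * m\<^sup>2 - 8 * m * D + 10 * D\<^sup>2
      + (z * (4 * D - 2 * m) + y * (3 * m - 7 * D - 2 * z + y))"
    unfolding Sy by (simp add: algebra_simps power2_eq_square)
  \<comment> \<open>This is the whole contribution of the vertices outside the five classes. It is
    largest at \<open>y = z\<close>, where it becomes a quadratic in \<open>z\<close> with maximum
    at most \<open>K\<^sup>2 / 4\<close>, or it is nonpositive.\<close>
  also have "z * (4 * D - 2 * m) + y * (3 * m - 7 * D - 2 * z + y) \<le> K\<^sup>2 / 4"
  proof -
    have 1: "y * (3 * m - 7 * D - 2 * z + y) \<le> y * (3 * m - 7 * D - z)"
      using y by (intro mult_left_mono) auto
    show ?thesis
    proof (cases "3 * m - 7 * D - z \<le> 0")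
      case True
      then have "y * (3 * m - 7 * D - z) \<le> 0" using y by (simp add: mult_nonneg_nonpos)
      moreover have "z * (4 * D - 2 * m) \<le> 0" using y D by (simp add: mult_nonneg_nonpos)
      moreover have "0 \<le> K\<^sup>2 / 4" by simp
      ultimately show ?thesis using 1 by linarith
    next
      case False
      then have "y * (3 * m - 7 * D - z) \<le> z * (3 * m - 7 * D - z)"
        using y by (intro mult_right_mono) auto
      then have "z * (4 * D - 2 * m) + y * (3 * m - 7 * D - 2 * z + y)
          \<le> z * (4 * D - 2 * m) + z * (3 * m - 7 * D - z)" using 1 by linarith
      also have "\<dots> = z * (m - 3 * D - z)" by (simp add: algebra_simps)
      also have "\<dots> \<le> z * (K - z)" using y K by (intro mult_left_mono) auto
      also have "\<dots> = K\<^sup>2 / 4 - (z - K / 2)\<^sup>2" by (simp add: field_simps power2_eq_square)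
      also have "\<dots> \<le> K\<^sup>2 / 4" by simp
      finally show ?thesis .
    qed
  qed
  finally show ?thesis by simp
qed

text \<open>Since cyclically consecutive sets are disjoint, a point lies in at most two of the five,
  and inside \<open>Z\<close> in at most one. The first equation is stated for \<open>N1\<close>
  only; the other four follow by rotating the indices.\<close>

lemma cyclically_disjoint_card:
  assumes "finite M" "N1 \<subseteq> M" "N2 \<subseteq> M" "N3 \<subseteq> M" "N4 \<subseteq> M" "N5 \<subseteq> M"
    and disj: "N1 \<inter> N2 = {}" "N2 \<inter> N3 = {}" "N3 \<inter> N4 = {}" "N4 \<inter> N5 = {}" "N5 \<inter> N1 = {}"
  defines "Z \<equiv> M - (N5 \<inter> N2 \<union> N1 \<inter> N3 \<union> N2 \<inter> N4 \<union> N3 \<inter> N5 \<union> N4 \<inter> N1)"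
  shows "card N1 = card (N4 \<inter> N1) + card (N1 \<inter> N3) + card (N1 \<inter> Z)"
    and "card (N1 \<inter> Z) + card (N2 \<inter> Z) + card (N3 \<inter> Z) + card (N4 \<inter> Z) + card (N5 \<inter> Z) \<le> card Z"
    and "sum f M = sum f (N5 \<inter> N2) + sum f (N1 \<inter> N3) + sum f (N2 \<inter> N4) + sum f (N3 \<inter> N5)
      + sum f (N4 \<inter> N1) + (sum f Z :: nat)"
proof -
  have fin: "finite N1" "finite N2" "finite N3" "finite N4" "finite N5" "finite Z"
    using assms(1-6) finite_subset by (auto simp: Z_def)
  have "N1 = (N4 \<inter> N1 \<union> N1 \<inter> N3) \<union> N1 \<inter> Z" using assms(2) disj by (auto simp: Z_def)
  then have "card N1 = card ((N4 \<inter> N1 \<union> N1 \<inter> N3) \<union> N1 \<inter> Z)" by simp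
  also have "\<dots> = card (N4 \<inter> N1 \<union> N1 \<inter> N3) + card (N1 \<inter> Z)"
    using fin by (intro card_Un_disjoint) (auto simp: Z_def)
  also have "card (N4 \<inter> N1 \<union> N1 \<inter> N3) = card (N4 \<inter> N1) + card (N1 \<inter> N3)"
    using fin disj by (intro card_Un_disjoint) auto
  finally show "card N1 = card (N4 \<inter> N1) + card (N1 \<inter> N3) + card (N1 \<inter> Z)" .
  have "card (N1 \<inter> Z) + card (N2 \<inter> Z) + card (N3 \<inter> Z) + card (N4 \<inter> Z) + card (N5 \<inter> Z)
    = card (N1 \<inter> Z \<union> N2 \<inter> Z \<union> N3 \<inter> Z \<union> N4 \<inter> Z \<union> N5 \<inter> Z)"
    using fin disj by (subst card_Un_disjoint; (auto simp: Z_def)?)+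
  also have "\<dots> \<le> card Z" using fin by (intro card_mono) auto
  finally show "card (N1 \<inter> Z) + card (N2 \<inter> Z) + card (N3 \<inter> Z) + card (N4 \<inter> Z) + card (N5 \<inter> Z)
    \<le> card Z" .
  have "M = N5 \<inter> N2 \<union> N1 \<inter> N3 \<union> N2 \<inter> N4 \<union> N3 \<inter> N5 \<union> N4 \<inter> N1 \<union> Z"
    using assms(2-6) by (auto simp: Z_def)
  then have "sum f M = sum f (N5 \<inter> N2 \<union> N1 \<inter> N3 \<union> N2 \<inter> N4 \<union> N3 \<inter> N5 \<union> N4 \<inter> N1 \<union> Z)"
    by simp
  also have "\<dots> = sum f (N5 \<inter> N2) + sum f (N1 \<inter> N3) + sum f (N2 \<inter> N4) + sum f (N3 \<inter> N5)
      + sum f (N4 \<inter> N1) + sum f Z"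
    using fin disj by (subst sum.union_disjoint; (auto simp: Z_def)?)+
  finally show "sum f M = sum f (N5 \<inter> N2) + sum f (N1 \<inter> N3) + sum f (N2 \<inter> N4) + sum f (N3 \<inter> N5)
      + sum f (N4 \<inter> N1) + sum f Z" .
qed

text \<open>A closed walk of length 5. In a loopless triangle-free graph its vertices are
  automatically distinct: \<open>t1 = t3\<close>, for example, would make \<open>t3\<close>,
  \<open>t4\<close>, \<open>t5\<close> a triangle.\<close>

definition pentagon :: "('a \<Rightarrow> 'a \<Rightarrow> bool) \<Rightarrow> 'a set \<Rightarrow> 'a \<Rightarrow> 'a \<Rightarrow> 'a \<Rightarrow> 'a \<Rightarrow> 'a \<Rightarrow> bool" where
  "pentagon E M t1 t2 t3 t4 t5 \<longleftrightarrow> {t1, t2, t3, t4, t5} \<subseteq> M \<and>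
    E t1 t2 \<and> E t2 t3 \<and> E t3 t4 \<and> E t4 t5 \<and> E t5 t1"

definition triangle_free_on :: "('a \<Rightarrow> 'a \<Rightarrow> bool) \<Rightarrow> 'a set \<Rightarrow> bool" where
  "triangle_free_on E M \<longleftrightarrow> \<not> (\<exists>x\<in>M. \<exists>y\<in>M. \<exists>z\<in>M. E x y \<and> E y z \<and> E x z)"

text \<open>Take a triangle-free supergraph on \<open>M\<close> with the most edges: two distinct
  non-adjacent vertices without a common neighbour could still be joined.\<close>

lemma triangle_free_saturation:
  assumes "finite M" "symp E" "irreflp E" "triangle_free_on E M"
  obtains F where "symp F" "irreflp F" "triangle_free_on F M"
    "\<And>x y. x \<in> M \<Longrightarrow> y \<in> M \<Longrightarrow> E x y \<Longrightarrow> F x y"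
    "\<And>x y. x \<in> M \<Longrightarrow> y \<in> M \<Longrightarrow> x \<noteq> y \<Longrightarrow> \<not> F x y \<Longrightarrow> \<exists>w\<in>M. F x w \<and> F y w"
proof -
  define P where "P = (\<lambda>F. symp F \<and> irreflp F \<and> triangle_free_on F M \<and>
    (\<forall>x\<in>M. \<forall>y\<in>M. E x y \<longrightarrow> F x y))"
  have "P E" using assms by (simp add: P_def)
  moreover have "\<forall>F. P F \<longrightarrow> card (edge_pairs F M) < Suc (card (M \<times> M))"
    using assms(1) by (intro allI impI le_imp_less_Suc card_mono) (auto simp: edge_pairs_def)
  ultimately have "\<exists>F. P F \<and> (\<forall>F'. P F' \<longrightarrow> card (edge_pairs F' M) \<le> card (edge_pairs F M))"
    by (rule ex_has_greatest_nat)
  then obtain F where F: "P F" and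
    F_max: "\<forall>F'. P F' \<longrightarrow> card (edge_pairs F' M) \<le> card (edge_pairs F M)"
    by (elim exE conjE)
  have "\<exists>w\<in>M. F x w \<and> F y w" if xy: "x \<in> M" "y \<in> M" "x \<noteq> y" "\<not> F x y" for x y
  proof (rule ccontr)
    assume no: "\<not> (\<exists>w\<in>M. F x w \<and> F y w)"
    define F' where "F' = (\<lambda>u v. F u v \<or> u = x \<and> v = y \<or> u = y \<and> v = x)"
    have sF: "\<And>u v. F u v \<Longrightarrow> F v u" and iF: "\<And>u. \<not> F u u"
      and tF: "\<And>u v w. u \<in> M \<Longrightarrow> v \<in> M \<Longrightarrow> w \<in> M \<Longrightarrow> F u v \<Longrightarrow> F v w \<Longrightarrow> \<not> F u w"
      using F unfolding P_def triangle_free_on_def by (meson sympD, meson irreflpD, blast)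
    have "symp F'" unfolding symp_def F'_def using sF by blast
    moreover have "irreflp F'" unfolding irreflp_def F'_def using iF xy by blast
    moreover have "triangle_free_on F' M"
      unfolding triangle_free_on_def F'_def
      by (intro notI; elim bexE conjE disjE; metis tF sF iF xy no)
    ultimately have "P F'" using F by (auto simp: P_def F'_def)
    moreover have "edge_pairs F M \<subset> edge_pairs F' M"
      using xy by (auto simp: edge_pairs_def F'_def)
    then have "card (edge_pairs F M) < card (edge_pairs F' M)"
      using assms(1) by (intro psubset_card_mono) auto
    ultimately show False using F_max leD by blast
  qed
  then show thesis using that[of F] F by (auto simp: P_def)
qed

text \<open>A parity argument: if each edge of the given 5-cycle had exactly one end adjacent to
  \<open>v\<close>, an odd cycle would be 2-coloured. So some edge \<open>x y\<close> has no end
  adjacent to \<open>v\<close>, and saturation supplies common neighbours of \<open>v\<close> with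
  \<open>x\<close> and with \<open>y\<close>.\<close>

lemma pentagon_through_vertex:
  assumes "symp E" "triangle_free_on E M"
    and sat: "\<And>x y. x \<in> M \<Longrightarrow> y \<in> M \<Longrightarrow> x \<noteq> y \<Longrightarrow> \<not> E x y \<Longrightarrow> \<exists>w\<in>M. E x w \<and> E y w"
    and pent: "pentagon E M t1 t2 t3 t4 t5" and v: "v \<in> M"
  obtains u2 u3 u4 u5 where "pentagon E M v u2 u3 u4 u5"
proof -
  have sE: "\<And>u v. E u v \<Longrightarrow> E v u"
    and tE: "\<And>u v w. u \<in> M \<Longrightarrow> v \<in> M \<Longrightarrow> w \<in> M \<Longrightarrow> E u v \<Longrightarrow> E v w \<Longrightarrow> \<not> E u w"
    using assms unfolding triangle_free_on_def by (meson sympD, blast)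
  have "\<exists>x\<in>M. \<exists>y\<in>M. E x y \<and> \<not> E v x \<and> \<not> E v y"
  proof (rule ccontr)
    assume "\<not> ?thesis"
    then have no: "E v x \<noteq> E v y" if "x \<in> M" "y \<in> M" "E x y" for x y
      using that tE[OF v, of x y] by blast
    show False
      using no[of t1 t2] no[of t2 t3] no[of t3 t4] no[of t4 t5] no[of t5 t1] pent
      by (auto simp: pentagon_def)
  qed
  then obtain x y where xy: "x \<in> M" "y \<in> M" "E x y" "\<not> E v x" "\<not> E v y" by blast
  have "x \<noteq> v" "y \<noteq> v" using xy sE by blast+
  then obtain p q where "p \<in> M" "E v p" "E x p" "q \<in> M" "E v q" "E y q"
    using sat[OF v, of x] sat[OF v, of y] xy by blast
  then have "pentagon E M v p x y q" using v xy sE by (auto simp: pentagon_def)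
  then show thesis by (rule that)
qed

text \<open>
  After saturating the graph take a 5-cycle of maximum degree sum. Swapping a vertex of the cycle for
  another common neighbour of its two cycle neighbours cannot increase that sum, which bounds the
  degrees class by class; every remaining vertex lies on some 5-cycle.
\<close>

theorem pentagon_edge_bound:
  fixes D K :: real
  assumes fin: "finite M" and "symp E" "irreflp E" "triangle_free_on E M"
    and pent: "pentagon E M s1 s2 s3 s4 s5"
    and deg: "\<And>v. v \<in> M \<Longrightarrow> real (card (nbrs E M v)) \<ge> D" and "D \<ge> 0"
    and K: "real (card M) \<le> 3 * D + K" "K \<ge> 0"
  shows "real (card (edge_pairs E M))
    \<le> 2 * (real (card M))\<^sup>2 - 8 * real (card M) * D + 10 * D\<^sup>2 + K\<^sup>2 / 4"
proof -
  obtain F where F: "symp F" "irreflp F" "triangle_free_on F M"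
    and EF: "\<And>x y. x \<in> M \<Longrightarrow> y \<in> M \<Longrightarrow> E x y \<Longrightarrow> F x y"
    and sat: "\<And>x y. x \<in> M \<Longrightarrow> y \<in> M \<Longrightarrow> x \<noteq> y \<Longrightarrow> \<not> F x y \<Longrightarrow> \<exists>w\<in>M. F x w \<and> F y w"
    using triangle_free_saturation[OF assms(1-4)] by blast
  have sF: "\<And>u v. F u v \<Longrightarrow> F v u"
    and tF: "\<And>u v w. u \<in> M \<Longrightarrow> v \<in> M \<Longrightarrow> w \<in> M \<Longrightarrow> F u v \<Longrightarrow> F v w \<Longrightarrow> \<not> F u w"
    using F unfolding triangle_free_on_def by (meson sympD, blast)
  define d where "d = (\<lambda>v. card (nbrs F M v))"
  have dD: "real (d v) \<ge> D" if "v \<in> M" for v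
  proof -
    have "card (nbrs E M v) \<le> d v"
      unfolding d_def using fin EF that by (intro card_mono) (auto simp: nbrs_def)
    then show ?thesis using deg[OF that] by linarith
  qed
  have "pentagon F M s1 s2 s3 s4 s5" using pent EF by (auto simp: pentagon_def)
  then have ex: "(\<lambda>(t1, t2, t3, t4, t5). pentagon F M t1 t2 t3 t4 t5) (s1, s2, s3, s4, s5)" by simp
  have bound: "\<forall>t. (\<lambda>(t1, t2, t3, t4, t5). pentagon F M t1 t2 t3 t4 t5) t \<longrightarrow>
    (\<lambda>(t1, t2, t3, t4, t5). d t1 + d t2 + d t3 + d t4 + d t5) t < Suc (5 * card M)"
  proof -
    have d_le: "d v \<le> card M" for v
      unfolding d_def using fin by (intro card_mono) (auto simp: nbrs_def)
    have "d u1 + d u2 + d u3 + d u4 + d u5 \<le> 5 * card M" for u1 u2 u3 u4 u5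
      using d_le[of u1] d_le[of u2] d_le[of u3] d_le[of u4] d_le[of u5] by linarith
    then show ?thesis by (auto simp: le_imp_less_Suc)
  qed
  obtain t1 t2 t3 t4 t5 where t: "pentagon F M t1 t2 t3 t4 t5"
    and t_max: "\<And>u1 u2 u3 u4 u5. pentagon F M u1 u2 u3 u4 u5 \<Longrightarrow>
      d u1 + d u2 + d u3 + d u4 + d u5 \<le> d t1 + d t2 + d t3 + d t4 + d t5"
    using ex_has_greatest_nat[OF ex bound] by fast
  have tM: "t1 \<in> M" "t2 \<in> M" "t3 \<in> M" "t4 \<in> M" "t5 \<in> M"
    and tE: "F t1 t2" "F t2 t3" "F t3 t4" "F t4 t5" "F t5 t1"
    using t by (auto simp: pentagon_def)
  define N1 N2 N3 N4 N5 where N: "N1 = nbrs F M t1" "N2 = nbrs F M t2" "N3 = nbrs F M t3"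
    "N4 = nbrs F M t4" "N5 = nbrs F M t5"
  define Z where "Z = M - (N5 \<inter> N2 \<union> N1 \<inter> N3 \<union> N2 \<inter> N4 \<union> N3 \<inter> N5 \<union> N4 \<inter> N1)"
  have sub: "N1 \<subseteq> M" "N2 \<subseteq> M" "N3 \<subseteq> M" "N4 \<subseteq> M" "N5 \<subseteq> M"
    by (auto simp: N nbrs_def)
  have disj: "N1 \<inter> N2 = {}" "N2 \<inter> N3 = {}" "N3 \<inter> N4 = {}" "N4 \<inter> N5 = {}" "N5 \<inter> N1 = {}"
    unfolding N nbrs_def using tF[OF tM(1,2)] tF[OF tM(2,3)] tF[OF tM(3,4)] tF[OF tM(4,5)]
      tF[OF tM(5,1)] tE by blast+
  have Zrot: "Z = M - (N1 \<inter> N3 \<union> N2 \<inter> N4 \<union> N3 \<inter> N5 \<union> N4 \<inter> N1 \<union> N5 \<inter> N2)"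
    "Z = M - (N2 \<inter> N4 \<union> N3 \<inter> N5 \<union> N4 \<inter> N1 \<union> N5 \<inter> N2 \<union> N1 \<inter> N3)"
    "Z = M - (N3 \<inter> N5 \<union> N4 \<inter> N1 \<union> N5 \<inter> N2 \<union> N1 \<inter> N3 \<union> N2 \<inter> N4)"
    "Z = M - (N4 \<inter> N1 \<union> N5 \<inter> N2 \<union> N1 \<inter> N3 \<union> N2 \<inter> N4 \<union> N3 \<inter> N5)"
    by (auto simp: Z_def)
  note cd = cyclically_disjoint_card
  define S where "S = d t1 + d t2 + d t3 + d t4 + d t5"
  have dN: "d t1 = card N1" "d t2 = card N2" "d t3 = card N3" "d t4 = card N4" "d t5 = card N5"
    by (simp_all add: d_def N)
  have split: "card N1 = card (N4 \<inter> N1) + card (N1 \<inter> N3) + card (N1 \<inter> Z)"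
    "card N2 = card (N5 \<inter> N2) + card (N2 \<inter> N4) + card (N2 \<inter> Z)"
    "card N3 = card (N1 \<inter> N3) + card (N3 \<inter> N5) + card (N3 \<inter> Z)"
    "card N4 = card (N2 \<inter> N4) + card (N4 \<inter> N1) + card (N4 \<inter> Z)"
    "card N5 = card (N3 \<inter> N5) + card (N5 \<inter> N2) + card (N5 \<inter> Z)"
    using cd(1)[OF fin sub disj, folded Z_def]
      cd(1)[OF fin sub(2-5,1) disj(2-5,1), folded Zrot(1)]
      cd(1)[OF fin sub(3-5,1,2) disj(3-5,1,2), folded Zrot(2)]
      cd(1)[OF fin sub(4-5,1-3) disj(4-5,1-3), folded Zrot(3)]
      cd(1)[OF fin sub(5,1-4) disj(5,1-4), folded Zrot(4)]
    by blast+
  note Zle = cd(2)[OF fin sub disj, folded Z_def]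
  note sumM = cd(3)[OF fin sub disj, folded Z_def]
  have sum_le: "real (sum d X) \<le> real (card X * c)" if "\<forall>v\<in>X. d v \<le> c" for X c
    using sum_bounded_above[of X d c] that by (simp only: of_nat_le_iff of_nat_id)
  have d1: "d v \<le> d t1" if "v \<in> N5 \<inter> N2" for v
    using t_max[of v t2 t3 t4 t5] that t sF unfolding pentagon_def N nbrs_def by force
  have d2: "d v \<le> d t2" if "v \<in> N1 \<inter> N3" for v
    using t_max[of t1 v t3 t4 t5] that t sF unfolding pentagon_def N nbrs_def by force
  have d3: "d v \<le> d t3" if "v \<in> N2 \<inter> N4" for v
    using t_max[of t1 t2 v t4 t5] that t sF unfolding pentagon_def N nbrs_def by force
  have d4: "d v \<le> d t4" if "v \<in> N3 \<inter> N5" for v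
    using t_max[of t1 t2 t3 v t5] that t sF unfolding pentagon_def N nbrs_def by force
  have d5: "d v \<le> d t5" if "v \<in> N4 \<inter> N1" for v
    using t_max[of t1 t2 t3 t4 v] that t sF unfolding pentagon_def N nbrs_def by force
  \<comment> \<open>On a 5-cycle through \<open>v\<close> the other four vertices have degree at
    least \<open>D\<close>, and the total is at most the maximum \<open>S\<close>.\<close>
  have dZ: "real (d v) \<le> real S - 4 * D" if v: "v \<in> Z" for v
  proof -
    have "v \<in> M" using v by (simp add: Z_def)
    then obtain u2 u3 u4 u5 where u: "pentagon F M v u2 u3 u4 u5"
      using pentagon_through_vertex[OF F(1,3) sat t] by blast
    then have "d v + d u2 + d u3 + d u4 + d u5 \<le> S" using t_max by (simp add: S_def)
    then have "real (d v + d u2 + d u3 + d u4 + d u5) \<le> real S" by (simp only: of_nat_le_iff)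
    then show ?thesis using u dD[of u2] dD[of u3] dD[of u4] dD[of u5] by (simp add: pentagon_def)
  qed
  have "card (edge_pairs E M) \<le> card (edge_pairs F M)"
    using EF by (intro card_mono finite_edge_pairs[OF fin]) (auto simp: edge_pairs_def)
  also have "card (edge_pairs F M) = sum d M" by (simp add: card_edge_pairs[OF fin] d_def)
  finally have "real (card (edge_pairs E M)) \<le> real (sum d M)" by (simp only: of_nat_le_iff)
  also have "real (sum d M) = real (sum d (N5 \<inter> N2)) + real (sum d (N1 \<inter> N3)) + real (sum d (N2 \<inter> N4))
      + real (sum d (N3 \<inter> N5)) + real (sum d (N4 \<inter> N1)) + (\<Sum>v\<in>Z. real (d v))"
    by (simp add: sumM)
  also have "\<dots> \<le> real (card (N5 \<inter> N2) * d t1) + real (card (N1 \<inter> N3) * d t2)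
      + real (card (N2 \<inter> N4) * d t3) + real (card (N3 \<inter> N5) * d t4) + real (card (N4 \<inter> N1) * d t5)
      + real (card Z) * (real S - 4 * D)"
  proof (intro add_mono)
    show "(\<Sum>v\<in>Z. real (d v)) \<le> real (card Z) * (real S - 4 * D)"
      by (rule sum_bounded_above) (rule dZ)
  qed (rule sum_le; use d1 d2 d3 d4 d5 in blast)+
  also have "\<dots> \<le> 2 * (real (card M))\<^sup>2 - 8 * real (card M) * D + 10 * D\<^sup>2 + K\<^sup>2 / 4"
    unfolding of_nat_mult
  proof (rule pentagon_class_arith[where ?z1.0 = "card (N1 \<inter> Z)" and ?z2.0 = "card (N2 \<inter> Z)"
        and ?z3.0 = "card (N3 \<inter> Z)" and ?z4.0 = "card (N4 \<inter> Z)" and ?z5.0 = "card (N5 \<inter> Z)"])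
    show "real (card M) = real (card (N5 \<inter> N2)) + real (card (N1 \<inter> N3)) + real (card (N2 \<inter> N4))
      + real (card (N3 \<inter> N5)) + real (card (N4 \<inter> N1)) + real (card Z)"
      using sumM[of "\<lambda>_. 1"] by simp
    show "real (card (N1 \<inter> Z)) + real (card (N2 \<inter> Z)) + real (card (N3 \<inter> Z))
      + real (card (N4 \<inter> Z)) + real (card (N5 \<inter> Z)) \<le> real (card Z)"
      using Zle by linarith
    have "card N1 + card N2 = card (N1 \<union> N2)"
      using sub disj(1) fin by (intro card_Un_disjoint[symmetric]) (auto intro: finite_subset)
    also have "\<dots> \<le> card M" using sub fin by (intro card_mono) auto
    finally have "real (d t1) + real (d t2) \<le> real (card M)" using dN by linarith
    then show "2 * D \<le> real (card M)" using dD[OF tM(1)] dD[OF tM(2)] by linarith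
    show "real S = real (d t1) + real (d t2) + real (d t3) + real (d t4) + real (d t5)"
      by (simp add: S_def)
  qed (use dD[OF tM(1)] dD[OF tM(2)] dD[OF tM(3)] dD[OF tM(4)] dD[OF tM(5)] K assms(7) in
      \<open>simp_all add: dN split\<close>)
  finally show ?thesis .
qed

section \<open>Wheels in saturated graphs\<close>

lemma card_nbrs_of_bool:
  assumes "finite W"
  shows "card (nbrs E W v) = (\<Sum>w\<in>W. of_bool (E v w))"
  using assms by (simp add: nbrs_def of_bool_def sum.If_cases Int_def)

text \<open>Double counting: in a triangle-free graph a vertex is never adjacent to two consecutive
  vertices of the cycle, hence to at most two of the five.\<close>

lemma pentagon_degree_sum:
  assumes "finite M" "triangle_free_on E M" and pent: "pentagon E M t1 t2 t3 t4 t5"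
  shows "card (nbrs E M t1) + card (nbrs E M t2) + card (nbrs E M t3) + card (nbrs E M t4)
    + card (nbrs E M t5) \<le> 2 * card M"
proof -
  have "of_bool (E t1 v) + of_bool (E t2 v) + of_bool (E t3 v) + of_bool (E t4 v)
      + of_bool (E t5 v) \<le> (2 :: nat)" if v: "v \<in> M" for v
  proof -
    have "\<not> (E t1 v \<and> E t2 v)" "\<not> (E t2 v \<and> E t3 v)" "\<not> (E t3 v \<and> E t4 v)"
      "\<not> (E t4 v \<and> E t5 v)" "\<not> (E t5 v \<and> E t1 v)"
      using assms(2) pent v unfolding triangle_free_on_def pentagon_def by blast+
    then show ?thesis by (auto simp: of_bool_def)
  qed
  then have "(\<Sum>v\<in>M. of_bool (E t1 v) + of_bool (E t2 v) + of_bool (E t3 v) + of_bool (E t4 v)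
      + of_bool (E t5 v)) \<le> (\<Sum>v\<in>M. (2 :: nat))"
    by (rule sum_mono)
  then show ?thesis
    by (simp add: card_nbrs_of_bool[OF assms(1)] sum.distrib)
qed

text \<open>The final inequality of \<open>no_wheel\<close>, where \<open>x\<close> is the
  proportion of non-neighbours of a hub. After multiplication by \<open>x\<^sup>2\<close> the
  difference of the two sides has the factor \<open>x - 1 / 3\<close>, so equality holds at
  \<open>x = 1 / 3\<close>.\<close>

lemma quartic_weight_bound:
  fixes x k :: real
  assumes "x * (1 - x) \<ge> 2 / 9" and k: "k = 4 / 45"
  shows "(1 - x)\<^sup>2 - 4 * (1 - x) * (k / x) + 5 * (k / x)\<^sup>2 \<le> k"
proof -
  have prod: "(x - 1 / 3) * (2 / 3 - x) \<ge> 0"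
    using assms(1) by (simp add: field_simps)
  then have x: "x \<ge> 1 / 3" "x \<le> 2 / 3"
    by (auto simp: zero_le_mult_iff)
  \<comment> \<open>Replacing \<open>x * x\<close> by its upper bound \<open>x - 2 / 9\<close> turns
    the cubic into a concave quadratic with maximum 121/1350 at \<open>x = 11 / 30\<close>.\<close>
  have "x * (x * x - 5 / 3 * x + 32 / 45) \<le> x * (22 / 45 - 2 / 3 * x)"
    using assms(1) x by (intro mult_left_mono) (auto simp: right_diff_distrib)
  also have "\<dots> = 16 / 135 - (2 / 3 * (x - 11 / 30)\<^sup>2 + (16 / 135 - 121 / 1350))"
    by (simp add: power2_eq_square field_simps)
  also have "\<dots> \<le> 16 / 135" using zero_le_power2[of "x - 11 / 30"] by linarith
  finally have "(x - 1 / 3) * (x * (x * x - 5 / 3 * x + 32 / 45) - 16 / 135) \<le> 0"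
    using x by (intro mult_nonneg_nonpos) auto
  also have "(x - 1 / 3) * (x * (x * x - 5 / 3 * x + 32 / 45) - 16 / 135)
      = x\<^sup>2 * ((1 - x)\<^sup>2 - 4 * (1 - x) * (k / x) + 5 * (k / x)\<^sup>2 - k)"
    using x unfolding k by (simp add: field_simps power2_eq_square)
  finally show ?thesis using x by (simp add: mult_le_0_iff)
qed

definition link :: "('a \<Rightarrow> 'a \<Rightarrow> 'a \<Rightarrow> bool) \<Rightarrow> 'a \<Rightarrow> ('a \<times> 'a) set" where
  "link T v = {(x, y). T v x y}"

text \<open>Here \<open>saturated\<close> with \<open>T_E\<close> makes two non-adjacent vertices
  the tips of a diamond whose middle edge is \<open>p q\<close>. The constant 8/45 is twice 4/45
  because \<open>link\<close> consists of ordered pairs.\<close>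

locale saturated_K4_free =
  fixes V :: "'a set" and E :: "'a \<Rightarrow> 'a \<Rightarrow> bool" and T :: "'a \<Rightarrow> 'a \<Rightarrow> 'a \<Rightarrow> bool"
  assumes finite_V: "finite V"
    and sym_E: "symp E" and irrefl_E: "irreflp E"
    and E_in_V: "E x y \<Longrightarrow> x \<in> V \<and> y \<in> V"
    and K4_free: "E a b \<Longrightarrow> E a c \<Longrightarrow> E a d \<Longrightarrow> E b c \<Longrightarrow> E b d \<Longrightarrow> \<not> E c d"
    and T_E: "T x y z \<Longrightarrow> E x y \<and> E x z \<and> E y z"
    and saturated: "x \<in> V \<Longrightarrow> y \<in> V \<Longrightarrow> x \<noteq> y \<Longrightarrow> \<not> E x y \<Longrightarrow> \<exists>p q. T x p q \<and> T y p q"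
    and link_gt: "v \<in> V \<Longrightarrow> real (card (link T v)) > 8 / 45 * (real (card V))\<^sup>2"
begin

lemma E_sym: "E x y \<Longrightarrow> E y x"
  using sym_E by (rule sympD)

lemma E_irrefl: "\<not> E x x"
  using irrefl_E by (rule irreflpD)

definition wheel :: "'a \<Rightarrow> 'a \<Rightarrow> 'a \<Rightarrow> 'a \<Rightarrow> 'a \<Rightarrow> 'a \<Rightarrow> bool" where
  "wheel a t1 t2 t3 t4 t5 \<longleftrightarrow> pentagon E (nbrs E V a) t1 t2 t3 t4 t5"

lemma triangle_free_nbrs: "triangle_free_on E (nbrs E V a)"
  unfolding triangle_free_on_def nbrs_def using K4_free by blast

lemma link_subset: "link T v \<subseteq> edge_pairs E (nbrs E V v)"
  unfolding link_def edge_pairs_def nbrs_def using T_E E_in_V by blast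

lemma card_link_le: "card (link T v) \<le> card (edge_pairs E (nbrs E V v))"
  using link_subset finite_V by (intro card_mono) auto

text \<open>The link of \<open>v\<close> lies in the graph on its neighbourhood, which is
  triangle-free, so Mantel's bound applies. The constant 149/250 is a rational just below the square
  root of 16/45.\<close>

lemma degree_gt:
  assumes "v \<in> V"
  shows "real (card (nbrs E V v)) > 149 / 250 * real (card V)"
proof -
  have "\<not> has_clique E (nbrs E V v) (Suc 2)"
  proof
    assume "has_clique E (nbrs E V v) (Suc 2)"
    then obtain K where K: "K \<subseteq> nbrs E V v" "card K = 3" "\<forall>x\<in>K. \<forall>y\<in>K. x \<noteq> y \<longrightarrow> E x y"
      unfolding has_clique_def by auto
    then obtain x y z where "K = {x, y, z}" "x \<noteq> y" "y \<noteq> z" "x \<noteq> z"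
      by (auto simp: card_3_iff)
    then have "x \<in> nbrs E V v" "y \<in> nbrs E V v" "z \<in> nbrs E V v" "E x y" "E y z" "E x z"
      using K by auto
    then show False using triangle_free_nbrs[of v] unfolding triangle_free_on_def by blast
  qed
  then have "2 * real (card (edge_pairs E (nbrs E V v))) \<le> (real (card (nbrs E V v)))\<^sup>2"
    using turan_edge_pairs[of "nbrs E V v" E 2] finite_V sym_E irrefl_E by simp
  moreover have "real (card (edge_pairs E (nbrs E V v))) > 8 / 45 * (real (card V))\<^sup>2"
    using link_gt[OF assms] card_link_le[of v] by linarith
  ultimately have "16 / 45 * (real (card V))\<^sup>2 < (real (card (nbrs E V v)))\<^sup>2" by linarith
  moreover have "(149 / 250 * real (card V))\<^sup>2 \<le> 16 / 45 * (real (card V))\<^sup>2"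
    by (simp add: power2_eq_square)
  ultimately show ?thesis by (meson le_less_trans of_nat_0_le_iff power_less_imp_less_base)
qed

abbreviation deg :: "'a \<Rightarrow> nat" where
  "deg v \<equiv> card (nbrs E V v)"

lemma wheelI:
  assumes "E a t1" "E a t2" "E a t3" "E a t4" "E a t5"
    "E t1 t2" "E t2 t3" "E t3 t4" "E t4 t5" "E t5 t1"
  shows "wheel a t1 t2 t3 t4 t5"
  using assms E_in_V unfolding wheel_def pentagon_def nbrs_def by blast

text \<open>The hub has weight 3 to balance two cases: a neighbour of the hub sees at most two rim
  vertices, as consecutive ones would give a K4, and any other vertex sees at most all five.\<close>

lemma wheel_degree_sum:
  assumes "wheel a t1 t2 t3 t4 t5"
  shows "3 * deg a + deg t1 + deg t2 + deg t3 + deg t4 + deg t5 \<le> 5 * card V"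
proof -
  have w: "E a t1" "E a t2" "E a t3" "E a t4" "E a t5"
    "E t1 t2" "E t2 t3" "E t3 t4" "E t4 t5" "E t5 t1"
    using assms by (auto simp: wheel_def pentagon_def nbrs_def)
  have "3 * of_bool (E a v) + of_bool (E t1 v) + of_bool (E t2 v) + of_bool (E t3 v)
      + of_bool (E t4 v) + of_bool (E t5 v) \<le> (5 :: nat)" for v
  proof (cases "E a v")
    case True
    have "\<not> (E t1 v \<and> E t2 v)" "\<not> (E t2 v \<and> E t3 v)" "\<not> (E t3 v \<and> E t4 v)"
      "\<not> (E t4 v \<and> E t5 v)" "\<not> (E t5 v \<and> E t1 v)"
      using K4_free[of a t1 t2 v] K4_free[of a t2 t3 v] K4_free[of a t3 t4 v] K4_free[of a t4 t5 v]
        K4_free[of a t5 t1 v] w True by blast+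
    then show ?thesis using True by (auto simp: of_bool_def)
  next
    case False
    then show ?thesis by (auto simp: of_bool_def)
  qed
  then have "(\<Sum>v\<in>V. 3 * of_bool (E a v) + of_bool (E t1 v) + of_bool (E t2 v) + of_bool (E t3 v)
      + of_bool (E t4 v) + of_bool (E t5 v)) \<le> (\<Sum>v\<in>V. (5 :: nat))"
    by (rule sum_mono)
  then show ?thesis
    by (simp add: card_nbrs_of_bool[OF finite_V] sum.distrib sum_distrib_left)
qed

text \<open>Saturation gives diamonds with middle edges \<open>p q\<close> (tips \<open>x\<close>,
  \<open>y\<close>) and \<open>r s\<close> (tips \<open>z\<close>, \<open>y\<close>). One vertex
  from each middle edge, together with \<open>x\<close>, \<open>y\<close>, \<open>z\<close> and the
  edge \<open>x z\<close>, forms the rim; a common neighbour of these five is the hub.\<close>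

lemma wheel_through_nontransitive:
  assumes V: "x \<in> V" "y \<in> V" "z \<in> V" and ne: "x \<noteq> y" "z \<noteq> y"
    and nE: "\<not> E x y" "\<not> E y z" and xz: "E x z"
  obtains b q s where "wheel b x q y s z"
proof -
  note wheel_thesis = that
  have nE': "\<not> E z y" using nE E_sym by blast
  obtain p q where pq: "E p q" "E x p" "E x q" "E y p" "E y q"
    using saturated[OF V(1,2) ne(1) nE(1)] T_E by blast
  obtain r s where rs: "E r s" "E z r" "E z s" "E y r" "E y s"
    using saturated[OF V(3,2) ne(2) nE'] T_E by blast
  \<comment> \<open>If \<open>pq\<close> and \<open>rs\<close> are disjoint, then \<open>x, p, q, y, r, s, z\<close> span a Moser spindle, and some
    vertex is adjacent to five of its seven vertices.\<close>
  have hub: thesis if b: "E b x" "E b q'" "E b y" "E b s'" "E b z"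
      and q': "q' \<in> {p, q}" and s': "s' \<in> {r, s}" for b q' s'
  proof (rule wheel_thesis)
    have "E x q'" "E q' y" "E y s'" "E s' z"
      using q' s' pq rs E_sym by auto
    then show "wheel b x q' y s' z"
      using b E_sym[OF xz] by (intro wheelI)
  qed
  show thesis
  proof (cases "p = r \<or> p = s \<or> q = r \<or> q = s")
    case True
    then consider "p = r" | "p = s" | "q = r" | "q = s" by blast
    then show thesis
    proof cases
      case 1
      show thesis by (rule hub[of p q s]) (use 1 pq rs in \<open>simp_all add: E_sym\<close>)
    next
      case 2
      show thesis by (rule hub[of p q r]) (use 2 pq rs in \<open>simp_all add: E_sym\<close>)
    next
      case 3
      show thesis by (rule hub[of q p s]) (use 3 pq rs in \<open>simp_all add: E_sym\<close>)
    next
      case 4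
      show thesis by (rule hub[of q p r]) (use 4 pq rs in \<open>simp_all add: E_sym\<close>)
    qed
  next
    case False
    have "\<exists>v\<in>V. \<exists>q'\<in>{p, q}. \<exists>s'\<in>{r, s}. E x v \<and> E q' v \<and> E y v \<and> E s' v \<and> E z v"
    proof (rule ccontr)
      assume no: "\<not> ?thesis"
      \<comment> \<open>If \<open>v\<close> sees both \<open>p\<close> and \<open>q\<close> it
        misses \<open>x\<close> and \<open>y\<close>, hence sees at most four; likewise for
        \<open>r\<close> and \<open>s\<close>. Otherwise five are reached only by \<open>x\<close>,
        \<open>y\<close>, \<open>z\<close> and one from each middle edge, which \<open>no\<close>
        excludes.\<close>
      have "of_bool (E x v) + of_bool (E p v) + of_bool (E q v) + of_bool (E y v)
          + of_bool (E r v) + of_bool (E s v) + of_bool (E z v) \<le> (4 :: nat)" if "v \<in> V" for v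
      proof -
        have "\<not> (E x v \<and> E p v \<and> E q v)" "\<not> (E y v \<and> E p v \<and> E q v)"
          "\<not> (E y v \<and> E r v \<and> E s v)" "\<not> (E z v \<and> E r v \<and> E s v)"
          using K4_free[of x p q v] K4_free[of y p q v] K4_free[of y r s v] K4_free[of z r s v] pq rs
          by blast+
        moreover have "\<not> (E x v \<and> E y v \<and> E z v \<and> (E p v \<or> E q v) \<and> (E r v \<or> E s v))"
          using no that by blast
        ultimately show ?thesis by (auto simp: of_bool_def)
      qed
      then have "(\<Sum>v\<in>V. of_bool (E x v) + of_bool (E p v) + of_bool (E q v) + of_bool (E y v)
          + of_bool (E r v) + of_bool (E s v) + of_bool (E z v)) \<le> (\<Sum>v\<in>V. (4 :: nat))"
        by (rule sum_mono)
      then have "deg x + deg p + deg q + deg y + deg r + deg s + deg z \<le> 4 * card V"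
        by (simp add: card_nbrs_of_bool[OF finite_V] sum.distrib)
      \<comment> \<open>Seven degrees above 149/250 of \<open>card V\<close> add up to more than
        \<open>4 * card V\<close>.\<close>
      then have "real (deg x + deg p + deg q + deg y + deg r + deg s + deg z) \<le> real (4 * card V)"
        by (simp only: of_nat_le_iff)
      moreover have "p \<in> V" "q \<in> V" "r \<in> V" "s \<in> V" using pq rs E_in_V by blast+
      ultimately show False
        using degree_gt[of x] degree_gt[of y] degree_gt[of z] degree_gt[of p] degree_gt[of q]
          degree_gt[of r] degree_gt[of s] V by simp
    qed
    then obtain v q' s' where v: "q' \<in> {p, q}" "s' \<in> {r, s}"
        "E x v" "E q' v" "E y v" "E s' v" "E z v"
      by blast
    show thesis by (rule hub[OF v(3-7)[THEN E_sym] v(1,2)])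
  qed
qed

text \<open>The neighbourhood of a hub is triangle-free and contains a 5-cycle. If it were small,
  \<open>pentagon_edge_bound\<close> would leave too few pairs for the link of the hub.\<close>

lemma hub_degree:
  assumes "wheel a t1 t2 t3 t4 t5"
  shows "real (deg a) > 33 / 50 * real (card V)"
proof (rule ccontr)
  assume le: "\<not> ?thesis"
  define n m where "n = real (card V)" and "m = real (deg a)"
  have aV: "a \<in> V" using assms(1) E_in_V unfolding wheel_def pentagon_def nbrs_def by blast
  then have n0: "n > 0" using finite_V by (auto simp: n_def card_gt_0_iff)
  have m: "m \<le> 33 / 50 * n" "m > 149 / 250 * n"
    using le degree_gt[OF aV] by (auto simp: n_def m_def)
  \<comment> \<open>A vertex has at most \<open>n - m\<close> neighbours outside the neighbourhood
    of \<open>a\<close>, and 1 - 149/250 = 101/250.\<close>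
  have "real (card (nbrs E (nbrs E V a) v)) \<ge> m - 101 / 250 * n" if "v \<in> nbrs E V a" for v
  proof -
    have "nbrs E V v \<subseteq> nbrs E (nbrs E V a) v \<union> (V - nbrs E V a)" by (auto simp: nbrs_def)
    then have "deg v \<le> card (nbrs E (nbrs E V a) v \<union> (V - nbrs E V a))"
      using finite_V by (intro card_mono) auto
    also have "\<dots> \<le> card (nbrs E (nbrs E V a) v) + card (V - nbrs E V a)" by (rule card_Un_le)
    also have "card (V - nbrs E V a) = card V - deg a"
      using finite_V by (intro card_Diff_subset) (auto simp: nbrs_def)
    finally have "deg v \<le> card (nbrs E (nbrs E V a) v) + (card V - deg a)" .
    moreover have "deg a \<le> card V" using finite_V by (intro card_mono) (auto simp: nbrs_def)
    moreover have "real (deg v) > 149 / 250 * n"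
      using degree_gt[of v] that by (simp add: nbrs_def n_def)
    ultimately show ?thesis unfolding n_def m_def by linarith
  qed
  \<comment> \<open>The slack \<open>K = n / 50\<close> is what \<open>m > 149 / 250 * n\<close>
    requires for \<open>m \<le> 3 * D + K\<close>.\<close>
  then have "real (card (edge_pairs E (nbrs E V a)))
    \<le> 2 * m\<^sup>2 - 8 * m * (m - 101 / 250 * n) + 10 * (m - 101 / 250 * n)\<^sup>2 + (1 / 50 * n)\<^sup>2 / 4"
    unfolding m_def using m n0 sym_E irrefl_E finite_V triangle_free_nbrs assms(1)
    by (intro pentagon_edge_bound) (auto simp: wheel_def m_def)
  also have "\<dots> = 4 * m\<^sup>2 - 606 / 125 * (m * n) + 81613 / 50000 * n\<^sup>2"
    by (simp add: algebra_simps power2_eq_square)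
  also have "\<dots> \<le> 8 / 45 * n\<^sup>2"
  proof -
    \<comment> \<open>By convexity \<open>m\<^sup>2\<close> lies below its chord over the allowed
      range; the resulting linear bound increases with \<open>m\<close>, so its worst case is
      \<open>m = 33 / 50 * n\<close>.\<close>
    have "(m - 149 / 250 * n) * (m - 33 / 50 * n) \<le> 0"
      using m by (intro mult_nonneg_nonpos) auto
    also have "(m - 149 / 250 * n) * (m - 33 / 50 * n)
        = m\<^sup>2 - 157 / 125 * (m * n) + 4917 / 12500 * n\<^sup>2"
      by (simp add: field_simps power2_eq_square)
    finally have "m\<^sup>2 \<le> 157 / 125 * (m * n) - 4917 / 12500 * n\<^sup>2" by simp
    moreover have "m * n \<le> 33 / 50 * n\<^sup>2"
      using mult_right_mono[OF m(1), of n] n0 by (simp add: power2_eq_square)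
    moreover have "n\<^sup>2 \<ge> 0" by simp
    ultimately show ?thesis by linarith
  qed
  finally show False using link_gt[OF aV] card_link_le[of a] by (simp add: n_def)
qed

text \<open>An edge among the non-neighbours would put the hub \<open>a\<close> on the rim of
  another wheel. Then two vertices, one with weight 3, have degree above 0.66n and four have degree
  above 0.596n, which exceeds the bound of \<open>wheel_degree_sum\<close>.\<close>

lemma wheel_nonneighbours_independent:
  assumes w: "wheel a t1 t2 t3 t4 t5" and "\<not> E a x" "\<not> E a z"
  shows "\<not> E x z"
proof
  assume xz: "E x z"
  have aV: "a \<in> V" using w E_in_V unfolding wheel_def pentagon_def nbrs_def by blast
  have xzV: "x \<in> V" "z \<in> V" using E_in_V[OF xz] by auto
  have ne: "x \<noteq> a" "z \<noteq> a" "\<not> E x a" using assms(2,3) xz E_sym by blast+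
  obtain b q s where b: "wheel b x q a s z"
    using wheel_through_nontransitive[OF xzV(1) aV xzV(2) ne assms(3) xz] .
  then have "q \<in> V" "s \<in> V" unfolding wheel_def pentagon_def nbrs_def by blast+
  moreover have "real (3 * deg b + deg x + deg q + deg a + deg s + deg z) \<le> real (5 * card V)"
    using wheel_degree_sum[OF b] by (simp only: of_nat_le_iff)
  moreover have "card V > 0" using aV finite_V by (auto simp: card_gt_0_iff)
  ultimately show False
    using hub_degree[OF b] hub_degree[OF w] degree_gt[of q] degree_gt[of s]
      degree_gt[OF xzV(1)] degree_gt[OF xzV(2)] by simp
qed

lemma no_wheel: "\<not> wheel a t1 t2 t3 t4 t5"
proof
  assume w: "wheel a t1 t2 t3 t4 t5"
  define M where "M = nbrs E V a"
  define A where "A = V - M"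
  define n m x k where "n = real (card V)" and "m = real (card M)" and "x = real (card A) / n"
    and "k = (4 / 45 :: real)"
  have finM: "finite M" "finite A" and MV: "M \<subseteq> V"
    using finite_V by (auto simp: M_def A_def nbrs_def)
  have aV: "a \<in> V" using w E_in_V unfolding wheel_def pentagon_def nbrs_def by blast
  have aA: "a \<in> A" using aV E_irrefl by (simp add: A_def M_def nbrs_def)
  have n0: "n > 0" using aV finite_V by (auto simp: n_def card_gt_0_iff)
  have "card A > 0" using aA finM by (auto simp: card_gt_0_iff)
  then have x0: "x > 0" and A_x: "real (card A) = x * n" using n0 by (auto simp: x_def)
  have "card A = card V - card M" unfolding A_def by (rule card_Diff_subset[OF finM(1) MV])
  then have "real (card A) = n - m"
    using card_mono[OF finite_V MV] by (simp add: n_def m_def of_nat_diff)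
  then have m_x: "m = (1 - x) * n" using A_x by (simp add: algebra_simps)
  have A_ind: "\<not> E y z" if "y \<in> A" "z \<in> A" for y z
    using wheel_nonneighbours_independent[OF w, of y z] that by (auto simp: A_def M_def nbrs_def)
  have M_tri: "triangle_free_on E M" unfolding M_def by (rule triangle_free_nbrs)
  have pent: "pentagon E M t1 t2 t3 t4 t5" using w by (simp add: wheel_def M_def)
  have degM: "real (card (nbrs E M t)) > k * n / x" if t: "t \<in> M" for t
  proof -
    \<comment> \<open>As \<open>A\<close> is independent and \<open>M\<close> triangle-free, exactly
      one of the two other vertices of a triple through \<open>t\<close> lies in
      \<open>A\<close>.\<close>
    have "link T t \<subseteq> A \<times> nbrs E M t \<union> nbrs E M t \<times> A"
    proof (rule subrelI)
      fix y z assume yz: "(y, z) \<in> link T t"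
      have E: "E t y" "E t z" "E y z" using yz T_E unfolding link_def by blast+
      have "y \<in> V" "z \<in> V" using E(3) E_in_V by blast+
      moreover have "\<not> (y \<in> M \<and> z \<in> M)"
        using M_tri t E unfolding triangle_free_on_def by blast
      ultimately show "(y, z) \<in> A \<times> nbrs E M t \<union> nbrs E M t \<times> A"
        using A_ind[of y z] E unfolding A_def nbrs_def by blast
    qed
    then have "card (link T t) \<le> card (A \<times> nbrs E M t \<union> nbrs E M t \<times> A)"
      using finM by (intro card_mono) auto
    also have "\<dots> \<le> card (A \<times> nbrs E M t) + card (nbrs E M t \<times> A)" by (rule card_Un_le)
    finally have "real (card (link T t)) \<le> real (2 * (card A * card (nbrs E M t)))"
      by (simp only: of_nat_le_iff card_cartesian_product) (simp add: mult.commute)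
    then have "2 * k * n\<^sup>2 < 2 * (x * n * real (card (nbrs E M t)))"
      using link_gt[of t] t MV by (auto simp: A_x n_def k_def)
    then have "n * (k * n) < n * (x * real (card (nbrs E M t)))"
      by (simp add: algebra_simps power2_eq_square)
    then have "k * n < x * real (card (nbrs E M t))" using n0 by simp
    then show ?thesis using x0 by (simp add: field_simps)
  qed
  have "real (card (nbrs E M t1) + card (nbrs E M t2) + card (nbrs E M t3) + card (nbrs E M t4)
      + card (nbrs E M t5)) \<le> real (2 * card M)"
    using pentagon_degree_sum[OF finM(1) M_tri pent] by (simp only: of_nat_le_iff)
  \<comment> \<open>Comparing the lower bound on degrees in \<open>M\<close> with the degree sum of
    the 5-cycle confines \<open>x\<close> to the range needed by
    \<open>quartic_weight_bound\<close>.\<close>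
  then have "5 * (k * n / x) \<le> 2 * ((1 - x) * n)"
    using degM[of t1] degM[of t2] degM[of t3] degM[of t4] degM[of t5] pent
    by (simp add: pentagon_def m_x[symmetric] m_def)
  then have "n * (5 * k) \<le> n * (2 * (x * (1 - x)))" using x0 by (simp add: field_simps)
  then have xx: "x * (1 - x) \<ge> 2 / 9" using n0 by (simp add: k_def)
  \<comment> \<open>Since x(1-x) is at most 1/4 and \<open>3 * k = 4 / 15\<close>, the pentagon
    bound applies with slack \<open>K = 0\<close>.\<close>
  have "(1 / 2 - x)\<^sup>2 \<ge> 0" by simp
  then have "x * (1 - x) \<le> 3 * k" by (simp add: power2_eq_square algebra_simps k_def)
  then have "n * (x * (1 - x)) \<le> n * (3 * k)" using n0 by simp
  then have m_le: "m \<le> 3 * (k * n / x) + 0" using x0 by (simp add: field_simps m_x)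
  have "real (card (edge_pairs E M)) \<le> 2 * m\<^sup>2 - 8 * m * (k * n / x) + 10 * (k * n / x)\<^sup>2 + 0\<^sup>2 / 4"
    unfolding m_def
    by (rule pentagon_edge_bound[OF finM(1) sym_E irrefl_E M_tri pent])
      (use degM m_le x0 n0 in \<open>auto simp: k_def m_def less_imp_le\<close>)
  also have "\<dots> = 2 * n\<^sup>2 * ((1 - x)\<^sup>2 - 4 * (1 - x) * (k / x) + 5 * (k / x)\<^sup>2)"
    by (simp add: m_x algebra_simps power2_eq_square)
  also have "\<dots> \<le> 2 * n\<^sup>2 * k"
    using quartic_weight_bound[OF xx k_def] by (intro mult_left_mono) auto
  finally show False
    using link_gt[OF aV] card_link_le[of a] by (simp add: M_def n_def k_def)
qed

section \<open>Non-adjacency as an equivalence relation\<close>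

lemma nonadjacency_trans:
  assumes "x \<in> V" "y \<in> V" "z \<in> V" "\<not> E x y" "\<not> E y z"
  shows "\<not> E x z"
proof
  assume "E x z"
  moreover from this have "x \<noteq> y" "z \<noteq> y" using assms E_sym by blast+
  ultimately show False
    using wheel_through_nontransitive[of x y z False] no_wheel assms by blast
qed

text \<open>The classes of the vertices of one triangle are disjoint by transitivity, and they cover
  \<open>V\<close> because a vertex adjacent to all three would give a K4.\<close>

theorem three_independent_classes:
  assumes "V \<noteq> {}"
  obtains A B C where "A \<union> B \<union> C = V" "A \<inter> B = {}" "A \<inter> C = {}" "B \<inter> C = {}"
    "\<And>x y. E x y \<Longrightarrow> \<not> {x, y} \<subseteq> A \<and> \<not> {x, y} \<subseteq> B \<and> \<not> {x, y} \<subseteq> C"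
proof -
  obtain v where v: "v \<in> V" using assms by blast
  have "link T v \<noteq> {}"
    using link_gt[OF v] by (auto simp: mult_less_0_iff)
  then obtain p q where "T v p q" unfolding link_def by blast
  then have E: "E v p" "E v q" "E p q" using T_E by blast+
  define cls where "cls = (\<lambda>u. {w \<in> V. \<not> E u w})"
  have disj: "cls u \<inter> cls w = {}" if "E u w" for u w
  proof (rule ccontr)
    assume "cls u \<inter> cls w \<noteq> {}"
    then obtain y where "y \<in> V" "\<not> E u y" "\<not> E y w" unfolding cls_def using E_sym[of _ w] by blast
    then show False using nonadjacency_trans[of u y w] that E_in_V[OF that] by blast
  qed
  have ind: "\<not> {x, y} \<subseteq> cls u" if "E x y" "u \<in> V" for x y u
    using nonadjacency_trans[of x u y] that E_in_V[OF that(1)] E_sym[of x u] unfolding cls_def by blast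
  have "cls v \<union> cls p \<union> cls q = V"
    using K4_free[OF E(1,2) _ E(3)] unfolding cls_def by blast
  moreover have "p \<in> V" "q \<in> V" using E_in_V E by blast+
  ultimately show thesis
    using that[of "cls v" "cls p" "cls q"] disj[OF E(1)] disj[OF E(2)] disj[OF E(3)] ind v by metis
qed

end

section \<open>Links in \<open>F\<^sub>5\<close>-free hypergraphs\<close>

text \<open>Bonferroni's inequality; writing the pairwise bound as \<open>2 * b\<close> cancels the
  2 in the number of pairs.\<close>

lemma card_UN_ge_pairwise:
  fixes c b :: real
  assumes "finite K" "\<And>v. v \<in> K \<Longrightarrow> finite (L v)" "\<And>v. v \<in> K \<Longrightarrow> c \<le> real (card (L v))"
    and "\<And>u v. u \<in> K \<Longrightarrow> v \<in> K \<Longrightarrow> u \<noteq> v \<Longrightarrow> real (card (L u \<inter> L v)) \<le> 2 * b"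
  shows "real (card K) * c - real (card K) * (real (card K) - 1) * b \<le> real (card (\<Union>v\<in>K. L v))"
  using assms
proof (induction K)
  case empty
  then show ?case by simp
next
  case (insert u K)
  define U where "U = (\<Union>v\<in>K. L v)"
  have IH: "real (card K) * c - real (card K) * (real (card K) - 1) * b \<le> real (card U)"
    unfolding U_def by (rule insert.IH) (use insert.prems in auto)
  have fin: "finite U" "finite (L u)" using insert by (auto simp: U_def)
  have "L u \<inter> U = (\<Union>v\<in>K. L u \<inter> L v)" by (auto simp: U_def)
  then have "card (L u \<inter> U) \<le> (\<Sum>v\<in>K. card (L u \<inter> L v))"
    using card_UN_le[OF insert.hyps(1), of "\<lambda>v. L u \<inter> L v"] by simp
  then have "real (card (L u \<inter> U)) \<le> (\<Sum>v\<in>K. real (card (L u \<inter> L v)))"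
    by (metis of_nat_le_iff of_nat_sum)
  also have "\<dots> \<le> real (card K) * (2 * b)"
    by (rule sum_bounded_above) (use insert.prems(3) insert.hyps(2) in auto)
  finally have "real (card (L u \<inter> U)) \<le> real (card K) * (2 * b)" .
  moreover have "real (card (L u)) + real (card U) = real (card (L u \<union> U)) + real (card (L u \<inter> U))"
    using card_Un_Int[OF fin(2,1)] by linarith
  moreover have "c \<le> real (card (L u))" using insert.prems(2) by simp
  moreover have "(\<Union>v\<in>insert u K. L v) = L u \<union> U" by (auto simp: U_def)
  ultimately show ?case using IH insert.hyps by (simp add: algebra_simps)
qed

lemma card_4_iff:
  "card S = 4 \<longleftrightarrow> (\<exists>a b c d. S = {a, b, c, d} \<and> distinct [a, b, c, d])"
proof
  assume "card S = 4"
  then have "card S = Suc 3" by simp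
  then obtain a S' where "S = insert a S'" "a \<notin> S'" "card S' = 3"
    unfolding card_Suc_eq by blast
  then show "\<exists>a b c d. S = {a, b, c, d} \<and> distinct [a, b, c, d]"
    by (auto simp: card_3_iff)
qed auto

text \<open>In \<open>F5_free\<close> the triples already force \<open>a\<close>, \<open>b\<close>,
  \<open>c\<close>, \<open>d\<close> to be distinct and \<open>e\<close> to differ from
  \<open>c\<close> and \<open>d\<close>; a coincidence of \<open>e\<close> with \<open>a\<close> or
  \<open>b\<close> is then the only alternative to a copy of \<open>F5\<close>.\<close>

locale F5_free_triples =
  fixes V :: "'a set" and T :: "'a \<Rightarrow> 'a \<Rightarrow> 'a \<Rightarrow> bool" and n :: nat
  assumes finite_V: "finite V" and card_V: "card V = n" and n_ge: "n \<ge> 5000"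
    and T_swap: "T x y z \<Longrightarrow> T y x z" and T_rotate: "T x y z \<Longrightarrow> T y z x"
    and T_in_V: "T x y z \<Longrightarrow> x \<in> V" and T_neq: "T x y z \<Longrightarrow> x \<noteq> y"
    and F5_free: "T a b c \<Longrightarrow> T a b d \<Longrightarrow> T c d e \<Longrightarrow> e = a \<or> e = b"
    and link_gt: "v \<in> V \<Longrightarrow> real (card (link T v)) > 8 / 45 * (real n)\<^sup>2"
begin

definition adj :: "'a \<Rightarrow> 'a \<Rightarrow> bool" where
  "adj x y \<longleftrightarrow> x \<in> V \<and> y \<in> V \<and> x \<noteq> y \<and> ((\<exists>z. T x y z) \<or> link T x \<inter> link T y = {})"

lemma T_adj: "T x y z \<Longrightarrow> adj x y \<and> adj x z \<and> adj y z"
  unfolding adj_def using T_in_V T_neq T_rotate T_swap by metis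

lemma symp_adj: "symp adj"
  unfolding symp_def adj_def using T_swap by blast

lemma irreflp_adj: "irreflp adj"
  by (simp add: irreflp_def adj_def)

lemma link_subset: "link T v \<subseteq> V \<times> V"
  unfolding link_def using T_in_V T_rotate by blast

lemma finite_link: "finite (link T v)"
  using link_subset finite_V by (meson finite_SigmaI finite_subset)

lemma card_star_le: "z \<in> V \<Longrightarrow> card ({z} \<times> V \<union> V \<times> {z}) \<le> 2 * n"
  using card_Un_le[of "{z} \<times> V" "V \<times> {z}"] by (simp add: card_V card_cartesian_product)

text \<open>If \<open>x y z\<close> is an edge and \<open>p q\<close> lies in both links, then
  \<open>p q x\<close>, \<open>p q y\<close>, \<open>x y z\<close> form an \<open>F5\<close> unless
  \<open>z\<close> is \<open>p\<close> or \<open>q\<close>. So all common pairs contain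
  \<open>z\<close>.\<close>

lemma card_link_Int:
  assumes "adj x y"
  shows "card (link T x \<inter> link T y) \<le> 2 * n"
proof (cases "\<exists>z. T x y z")
  case True
  then obtain z where z: "T x y z" by blast
  have "link T x \<inter> link T y \<subseteq> {z} \<times> V \<union> V \<times> {z}"
  proof (rule subrelI)
    fix p q assume "(p, q) \<in> link T x \<inter> link T y"
    then have pq: "T x p q" "T y p q" by (auto simp: link_def)
    then have "z = p \<or> z = q"
      using F5_free[OF T_rotate[OF pq(1)] T_rotate[OF pq(2)] z] by blast
    moreover have "p \<in> V" "q \<in> V" using pq T_rotate T_in_V by blast+
    ultimately show "(p, q) \<in> {z} \<times> V \<union> V \<times> {z}" by blast
  qed
  then have "card (link T x \<inter> link T y) \<le> card ({z} \<times> V \<union> V \<times> {z})"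
    using finite_V by (intro card_mono) auto
  also have "\<dots> \<le> 2 * n" using card_star_le z T_rotate T_in_V by blast
  finally show ?thesis .
next
  case False
  then show ?thesis using assms by (simp add: adj_def)
qed

section \<open>Excluding cliques on six, five and four vertices in turn\<close>

lemma card_UN_link_ge:
  assumes "K \<subseteq> V" "\<forall>x\<in>K. \<forall>y\<in>K. x \<noteq> y \<longrightarrow> adj x y"
  shows "real (card K) * (8 / 45 * (real n)\<^sup>2) - real (card K) * (real (card K) - 1) * real n
    \<le> real (card (\<Union>v\<in>K. link T v))"
proof (rule card_UN_ge_pairwise)
  show "finite K" using assms(1) finite_V by (rule finite_subset)
  show "8 / 45 * (real n)\<^sup>2 \<le> real (card (link T v))" if "v \<in> K" for v
    using link_gt[of v] that assms(1) by auto
  show "real (card (link T u \<inter> link T v)) \<le> 2 * real n" if "u \<in> K" "v \<in> K" "u \<noteq> v" for u v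
    using card_link_Int[of u v] assms(2) that by (metis of_nat_le_iff of_nat_mult of_nat_numeral)
qed (rule finite_link)

lemma n_bounds: "real n > 0" "real n * 5000 \<le> (real n)\<^sup>2"
  using n_ge by (auto simp: power2_eq_square mult.commute)

text \<open>Six almost disjoint links would contain about 48/45 of all n^2 pairs.\<close>

lemma no_K6: "\<not> has_clique adj V (Suc 5)"
proof
  assume "has_clique adj V (Suc 5)"
  then obtain K where K: "K \<subseteq> V" "card K = 6" "\<forall>x\<in>K. \<forall>y\<in>K. x \<noteq> y \<longrightarrow> adj x y"
    by (auto simp: has_clique_def)
  have "card (\<Union>v\<in>K. link T v) \<le> card (V \<times> V)"
    using link_subset finite_V by (intro card_mono) auto
  then have "real (card (\<Union>v\<in>K. link T v)) \<le> real (card (V \<times> V))" by (simp only: of_nat_le_iff)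
  also have "\<dots> = (real n)\<^sup>2" by (simp add: card_cartesian_product card_V power2_eq_square)
  finally show False
    using card_UN_link_ge[OF K(1,3), unfolded K(2), simplified] n_bounds by linarith
qed

text \<open>Link pairs are adjacent pairs, of which there are at most 4/5 n^2 by Turan and
  \<open>no_K6\<close>, whereas five links need about 8/9 n^2.\<close>

lemma no_K5: "\<not> has_clique adj V 5"
proof
  assume "has_clique adj V 5"
  then obtain K where K: "K \<subseteq> V" "card K = 5" "\<forall>x\<in>K. \<forall>y\<in>K. x \<noteq> y \<longrightarrow> adj x y"
    by (auto simp: has_clique_def)
  have "(\<Union>v\<in>K. link T v) \<subseteq> edge_pairs adj V"
    using link_subset T_adj unfolding link_def edge_pairs_def by blast
  then have "card (\<Union>v\<in>K. link T v) \<le> card (edge_pairs adj V)"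
    using finite_V by (intro card_mono) auto
  then have "real (card (\<Union>v\<in>K. link T v)) \<le> real (card (edge_pairs adj V))" by simp
  then show False
    using card_UN_link_ge[OF K(1,3)] n_bounds
      turan_edge_pairs[OF finite_V symp_adj irreflp_adj no_K6] unfolding K(2)
    by (simp add: card_V)
qed

text \<open>
  A pair lying in a triangle of the link of \<open>v\<close> has codegree at most 2, so only boundedly many
  vertices can have many such pairs.
\<close>

definition tri :: "'a \<Rightarrow> ('a \<times> 'a) set" where
  "tri v = {(z, w). \<exists>y. T v y z \<and> T v y w \<and> T v z w}"

definition bad :: "'a set" where
  "bad = {v \<in> V. real (card (tri v)) > (real n)\<^sup>2 / 100}"

lemma card_bad: "card bad \<le> 200"
proof -
  have "(\<Sum>v\<in>V. card (tri v)) = (\<Sum>v\<in>V. \<Sum>p\<in>V \<times> V. of_bool (p \<in> tri v))"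
  proof (rule sum.cong[OF refl])
    fix v
    have "tri v \<subseteq> V \<times> V" using link_subset[of v] by (auto simp: tri_def link_def)
    then have "(V \<times> V) \<inter> {p. p \<in> tri v} = tri v" by auto
    then show "card (tri v) = (\<Sum>p\<in>V \<times> V. of_bool (p \<in> tri v))"
      using finite_V by (simp add: of_bool_def sum.If_cases)
  qed
  also have "\<dots> = (\<Sum>p\<in>V \<times> V. \<Sum>v\<in>V. of_bool (p \<in> tri v))" by (rule sum.swap)
  also have "\<dots> \<le> (\<Sum>p\<in>V \<times> V. 2)"
  proof (rule sum_mono)
    fix p
    show "(\<Sum>v\<in>V. of_bool (p \<in> tri v)) \<le> (2 :: nat)"
    proof (cases "\<exists>v. p \<in> tri v")
      case True
      then obtain v y z w where p: "p = (z, w)" "T v y z" "T v y w" by (auto simp: tri_def)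
      \<comment> \<open>The triples \<open>v y z\<close>, \<open>v y w\<close> and
        \<open>z w u\<close> form an \<open>F5\<close> unless \<open>u\<close> is \<open>v\<close>
        or \<open>y\<close>.\<close>
      have "V \<inter> {u. p \<in> tri u} \<subseteq> {v, y}"
        using F5_free[OF p(2,3)] T_rotate unfolding tri_def p(1) by blast
      then have "card (V \<inter> {u. p \<in> tri u}) \<le> card {v, y}" by (intro card_mono) auto
      also have "\<dots> \<le> 2" by (simp add: card_insert_if)
      finally show ?thesis using finite_V by (simp add: of_bool_def sum.If_cases)
    next
      case False
      then show ?thesis by simp
    qed
  qed
  also have "\<dots> = 2 * n\<^sup>2" by (simp add: card_cartesian_product card_V power2_eq_square)
  finally have "real (\<Sum>v\<in>V. card (tri v)) \<le> real (2 * n\<^sup>2)" by (simp only: of_nat_le_iff)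
  have finb: "finite bad" "bad \<subseteq> V" using finite_V by (auto simp: bad_def)
  have "real (card bad) * ((real n)\<^sup>2 / 100) \<le> (\<Sum>v\<in>bad. real (card (tri v)))"
    by (rule sum_bounded_below) (auto simp: bad_def)
  also have "\<dots> \<le> (\<Sum>v\<in>V. real (card (tri v)))"
    using finb finite_V by (intro sum_mono2) auto
  also have "\<dots> \<le> 2 * (real n)\<^sup>2"
    using \<open>real (\<Sum>v\<in>V. card (tri v)) \<le> real (2 * n\<^sup>2)\<close> by simp
  finally have "real (card bad) * (real n)\<^sup>2 \<le> 200 * (real n)\<^sup>2" by simp
  then show ?thesis using n_bounds by simp
qed

text \<open>The links of a 4-clique \<open>K\<close>, without their triangle pairs and the pairs
  meeting \<open>K\<close>, form a graph \<open>F\<close>. It is shown to be K4-free, so Turan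
  allows it 2/3 n^2 pairs, slightly fewer than the four links supply.\<close>

lemma no_K4_outside_bad: "\<not> has_clique adj (V - bad) (Suc 3)"
proof
  assume "has_clique adj (V - bad) (Suc 3)"
  then obtain K where K: "K \<subseteq> V - bad" "card K = 4" "\<forall>x\<in>K. \<forall>y\<in>K. x \<noteq> y \<longrightarrow> adj x y"
    by (auto simp: has_clique_def)
  have KV: "K \<subseteq> V" and finK: "finite K" using K(1) finite_V finite_subset by auto
  define L where "L = (\<lambda>i. link T i - tri i)"
  define F where "F = (\<lambda>x y. x \<notin> K \<and> y \<notin> K \<and> (\<exists>i\<in>K. (x, y) \<in> L i))"
  have tri_sym: "(x, y) \<in> tri i \<Longrightarrow> (y, x) \<in> tri i" for x y i
    unfolding tri_def using T_swap T_rotate by blast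
  have L_sym: "(x, y) \<in> L i \<Longrightarrow> (y, x) \<in> L i" for x y i
    unfolding L_def link_def using tri_sym T_swap T_rotate by blast
  have F_adj: "adj x y" if "F x y" for x y
    using that T_adj unfolding F_def L_def link_def by blast
  have F_sym: "symp F" unfolding symp_def F_def using L_sym by blast
  have F_irrefl: "irreflp F" using F_adj irreflp_adj unfolding irreflp_def by blast
  have cherry: False
    if L: "(p, q) \<in> L i" "(p, r) \<in> L i" and F: "F q r" and p: "p \<notin> K" and i: "i \<in> K" for p q r i
  proof -
    have T1: "T i p q" "T i p r" and nt: "(p, q) \<notin> tri i"
      using L by (auto simp: L_def link_def)
    obtain j where j: "j \<in> K" "T j q r" using F by (auto simp: F_def L_def link_def)
    \<comment> \<open>Two pairs of one colour sharing \<open>p\<close> force the third pair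
      \<open>q r\<close> into the same link, so \<open>p q\<close> would lie in a triangle of that
      link, and such pairs were removed.\<close>
    have "j = i \<or> j = p" using F5_free[OF T1 T_rotate[OF j(2)]] .
    then have "T i q r" using j p by blast
    then have "(p, q) \<in> tri i"
      unfolding tri_def using T1 T_swap T_rotate by blast
    then show False using nt by blast
  qed
  \<comment> \<open>Two opposite pairs of one colour \<open>i\<close> make \<open>i\<close> adjacent
    to all four vertices, giving a 5-clique.\<close>
  have matching: False if xy: "(x, y) \<in> L i" "(z, w) \<in> L i" "i \<in> K"
    and F: "F x y" "F x z" "F x w" "F y z" "F y w" "F z w" for x y z w i
  proof -
    have T1: "T i x y" "T i z w" using xy by (auto simp: L_def link_def)
    have a: "adj i x" "adj i y" "adj i z" "adj i w" using T1 T_adj by blast+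
    have b: "adj x y" "adj x z" "adj x w" "adj y z" "adj y w" "adj z w" using F F_adj by blast+
    have "distinct [i, x, y, z, w]" using a b by (auto simp: adj_def)
    then have "card {i, x, y, z, w} = 5" by simp
    moreover have "{i, x, y, z, w} \<subseteq> V" using a by (auto simp: adj_def)
    moreover have "\<forall>u\<in>{i, x, y, z, w}. \<forall>v\<in>{i, x, y, z, w}. u \<noteq> v \<longrightarrow> adj u v"
      using a b a[THEN sympD[OF symp_adj]] b[THEN sympD[OF symp_adj]] by auto
    ultimately show False using no_K5 unfolding has_clique_def by blast
  qed
  \<comment> \<open>Colour a pair by a vertex of \<open>K\<close> whose link contains it: the six pairs of a clique of
    \<open>F\<close> would receive six different colours.\<close>
  have "\<not> has_clique F V (Suc 3)"
  proof
    assume "has_clique F V (Suc 3)"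
    then obtain Q where Q: "card Q = 4" "\<forall>x\<in>Q. \<forall>y\<in>Q. x \<noteq> y \<longrightarrow> F x y"
      by (auto simp: has_clique_def)
    then obtain x y z w where xyzw: "Q = {x, y, z, w}" "distinct [x, y, z, w]"
      by (auto simp: card_4_iff)
    then have F: "F x y" "F x z" "F x w" "F y z" "F y w" "F z w" using Q(2) by auto
    note F' = F[THEN sympD[OF F_sym]]
    have nK: "x \<notin> K" "y \<notin> K" "z \<notin> K" "w \<notin> K" using F by (auto simp: F_def)
    obtain i1 i2 i3 i4 i5 i6 where i: "i1 \<in> K" "i2 \<in> K" "i3 \<in> K" "i4 \<in> K" "i5 \<in> K" "i6 \<in> K"
      and L: "(x, y) \<in> L i1" "(x, z) \<in> L i2" "(x, w) \<in> L i3" "(y, z) \<in> L i4" "(y, w) \<in> L i5"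
        "(z, w) \<in> L i6"
      using F unfolding F_def by blast
    note L' = L[THEN L_sym]
    have "i1 \<noteq> i2" using cherry[OF L(1) _ F(4) nK(1) i(1)] L(2) by blast
    moreover have "i1 \<noteq> i3" using cherry[OF L(1) _ F(5) nK(1) i(1)] L(3) by blast
    moreover have "i1 \<noteq> i4" using cherry[OF L'(1) _ F(2) nK(2) i(1)] L(4) by blast
    moreover have "i1 \<noteq> i5" using cherry[OF L'(1) _ F(3) nK(2) i(1)] L(5) by blast
    moreover have "i1 \<noteq> i6" using matching[OF L(1) _ i(1) F] L(6) by blast
    moreover have "i2 \<noteq> i3" using cherry[OF L(2) _ F(6) nK(1) i(2)] L(3) by blast
    moreover have "i2 \<noteq> i4" using cherry[OF L'(2) _ F(1) nK(3) i(2)] L'(4) by blast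
    moreover have "i2 \<noteq> i5" using matching[OF L(2) _ i(2) F(2,1,3) F'(4) F(6,5)] L(5) by blast
    moreover have "i2 \<noteq> i6" using cherry[OF L'(2) _ F(3) nK(3) i(2)] L(6) by blast
    moreover have "i3 \<noteq> i4" using matching[OF L(3) _ i(3) F(3,1,2) F'(5,6) F(4)] L(4) by blast
    moreover have "i3 \<noteq> i5" using cherry[OF L'(3) _ F(1) nK(4) i(3)] L'(5) by blast
    moreover have "i3 \<noteq> i6" using cherry[OF L'(3) _ F(2) nK(4) i(3)] L'(6) by blast
    moreover have "i4 \<noteq> i5" using cherry[OF L(4) _ F(6) nK(2) i(4)] L(5) by blast
    moreover have "i4 \<noteq> i6" using cherry[OF L'(4) _ F(5) nK(3) i(4)] L(6) by blast
    moreover have "i5 \<noteq> i6" using cherry[OF L'(5) _ F(4) nK(4) i(5)] L'(6) by blast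
    ultimately have "card {i1, i2, i3, i4, i5, i6} = 6" by simp
    moreover have "card {i1, i2, i3, i4, i5, i6} \<le> card K"
      using i finK by (intro card_mono) auto
    ultimately show False using K(2) by simp
  qed
  then have F_le: "3 * real (card (edge_pairs F V)) \<le> 2 * (real n)\<^sup>2"
    using turan_edge_pairs[OF finite_V F_sym F_irrefl, of 3] by (simp add: card_V)
  have L_card: "8 / 45 * (real n)\<^sup>2 - (real n)\<^sup>2 / 100 \<le> real (card (L v))" if v: "v \<in> K" for v
  proof -
    have "finite (tri v)" by (rule finite_subset[OF _ finite_link[of v]]) (auto simp: tri_def link_def)
    then have "card (link T v) - card (tri v) \<le> card (L v)"
      unfolding L_def by (rule diff_card_le_card_Diff)
    moreover have "real (card (tri v)) \<le> (real n)\<^sup>2 / 100" "v \<in> V"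
      using v K(1) by (auto simp: bad_def)
    ultimately show ?thesis using link_gt[of v] by linarith
  qed
  have L_Int: "real (card (L u \<inter> L v)) \<le> 2 * real n" if "u \<in> K" "v \<in> K" "u \<noteq> v" for u v
  proof -
    have "card (L u \<inter> L v) \<le> card (link T u \<inter> link T v)"
      using finite_link by (intro card_mono) (auto simp: L_def)
    also have "\<dots> \<le> 2 * n" using K(3) that by (intro card_link_Int) blast
    finally have "real (card (L u \<inter> L v)) \<le> real (2 * n)" by (simp only: of_nat_le_iff)
    then show ?thesis by simp
  qed
  have "(\<Union>v\<in>K. L v) \<subseteq> edge_pairs F V \<union> (\<Union>z\<in>K. {z} \<times> V \<union> V \<times> {z})"
  proof (rule subrelI)
    fix x y assume xy: "(x, y) \<in> (\<Union>v\<in>K. L v)"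
    then have "x \<in> V" "y \<in> V" using link_subset by (auto simp: L_def)
    then show "(x, y) \<in> edge_pairs F V \<union> (\<Union>z\<in>K. {z} \<times> V \<union> V \<times> {z})"
      using xy unfolding edge_pairs_def F_def by blast
  qed
  then have "card (\<Union>v\<in>K. L v) \<le> card (edge_pairs F V \<union> (\<Union>z\<in>K. {z} \<times> V \<union> V \<times> {z}))"
    using finK finite_V by (intro card_mono) auto
  also have "\<dots> \<le> card (edge_pairs F V) + card (\<Union>z\<in>K. {z} \<times> V \<union> V \<times> {z})"
    by (rule card_Un_le)
  also have "card (\<Union>z\<in>K. {z} \<times> V \<union> V \<times> {z}) \<le> (\<Sum>z\<in>K. card ({z} \<times> V \<union> V \<times> {z}))"
    using finK by (rule card_UN_le)
  also have "\<dots> \<le> card K * (2 * n)"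
    using sum_bounded_above[of K "\<lambda>z. card ({z} \<times> V \<union> V \<times> {z})" "2 * n"] card_star_le KV by auto
  finally have "card (\<Union>v\<in>K. L v) \<le> card (edge_pairs F V) + 8 * n" using K(2) by simp
  then have "real (card (\<Union>v\<in>K. L v)) \<le> real (card (edge_pairs F V)) + 8 * real n" by linarith
  moreover have "real (card K) * (8 / 45 * (real n)\<^sup>2 - (real n)\<^sup>2 / 100)
      - real (card K) * (real (card K) - 1) * real n \<le> real (card (\<Union>v\<in>K. L v))"
    using finK finite_link L_card L_Int by (intro card_UN_ge_pairwise) (auto simp: L_def)
  \<comment> \<open>Four reduced links give 151/225 n^2 - 12n, against 2/3 n^2 + 8n; the
    contradiction needs n above 4500.\<close>
  ultimately show False using F_le n_bounds unfolding K(2) by simp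
qed

text \<open>Turan is applied only to \<open>W\<close>, where K4 is already excluded, and all pairs
  meeting \<open>bad\<close> are conceded. The total stays below 0.7 n^2, while four links need
  about 32/45 n^2.\<close>

lemma no_K4: "\<not> has_clique adj V 4"
proof
  assume "has_clique adj V 4"
  then obtain K where K: "K \<subseteq> V" "card K = 4" "\<forall>x\<in>K. \<forall>y\<in>K. x \<noteq> y \<longrightarrow> adj x y"
    by (auto simp: has_clique_def)
  define W where "W = V - bad"
  have W: "W \<subseteq> V" "finite W" using finite_V by (auto simp: W_def)
  have "3 * real (card (edge_pairs adj W)) \<le> 2 * (real (card W))\<^sup>2"
    using turan_edge_pairs[OF W(2) symp_adj irreflp_adj, of 3] no_K4_outside_bad
    by (simp add: W_def)
  moreover have "(\<Union>v\<in>K. link T v) \<subseteq> edge_pairs adj W \<union> (V \<times> V - W \<times> W)"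
    using link_subset T_adj unfolding link_def edge_pairs_def by blast
  then have "card (\<Union>v\<in>K. link T v) \<le> card (edge_pairs adj W \<union> (V \<times> V - W \<times> W))"
    using finite_V W by (intro card_mono) auto
  then have "card (\<Union>v\<in>K. link T v) \<le> card (edge_pairs adj W) + card (V \<times> V - W \<times> W)"
    using card_Un_le le_trans by blast
  then have "real (card (\<Union>v\<in>K. link T v))
      \<le> real (card (edge_pairs adj W)) + real (card (V \<times> V - W \<times> W))" by linarith
  moreover have "real (card (V \<times> V - W \<times> W)) = (real n)\<^sup>2 - (real (card W))\<^sup>2"
  proof -
    have "card (V \<times> V - W \<times> W) = card (V \<times> V) - card (W \<times> W)"
      using W by (intro card_Diff_subset) auto
    moreover have "card (W \<times> W) \<le> card (V \<times> V)" using W finite_V by (intro card_mono) auto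
    ultimately show ?thesis
      by (simp add: of_nat_diff card_cartesian_product card_V power2_eq_square)
  qed
  \<comment> \<open>At most 200 bad vertices are at most n/25 of all vertices, precisely because n
    is at least 5000.\<close>
  moreover have "(24 / 25 * real n)\<^sup>2 \<le> (real (card W))\<^sup>2"
  proof (rule power_mono)
    have "finite bad" using finite_V by (simp add: bad_def)
    then have "card V - card bad \<le> card W" unfolding W_def by (rule diff_card_le_card_Diff)
    then show "24 / 25 * real n \<le> real (card W)" using card_bad n_ge card_V by linarith
  qed simp
  then have "576 / 625 * (real n)\<^sup>2 \<le> (real (card W))\<^sup>2"
    by (simp only: power_mult_distrib) (simp add: power2_eq_square)
  ultimately show False
    using card_UN_link_ge[OF K(1,3), unfolded K(2), simplified] n_bounds by linarith
qed

sublocale saturated_K4_free V adj T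
proof
  show "finite V" "symp adj" "irreflp adj" by (fact finite_V symp_adj irreflp_adj)+
  show "x \<in> V \<and> y \<in> V" if "adj x y" for x y using that by (simp add: adj_def)
  show "\<not> adj c d" if "adj a b" "adj a c" "adj a d" "adj b c" "adj b d" for a b c d
  proof
    assume "adj c d"
    note a = that this
    have "distinct [a, b, c, d]" using a by (auto simp: adj_def)
    then have "card {a, b, c, d} = 4" by simp
    moreover have "{a, b, c, d} \<subseteq> V" using a by (auto simp: adj_def)
    moreover have "\<forall>u\<in>{a, b, c, d}. \<forall>v\<in>{a, b, c, d}. u \<noteq> v \<longrightarrow> adj u v"
      using a a[THEN sympD[OF symp_adj]] by auto
    ultimately show False using no_K4 unfolding has_clique_def by blast
  qed
  show "adj x y \<and> adj x z \<and> adj y z" if "T x y z" for x y z using that by (rule T_adj)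
  show "\<exists>p q. T x p q \<and> T y p q" if "x \<in> V" "y \<in> V" "x \<noteq> y" "\<not> adj x y" for x y
    using that unfolding adj_def link_def by blast
  show "8 / 45 * (real (card V))\<^sup>2 < real (card (link T v))" if "v \<in> V" for v
    using link_gt[OF that] by (simp add: card_V)
qed

end

section \<open>From the set system to ordered triples, and the conclusion\<close>

lemma F5_free_edges:
  assumes "F5_free V H" "three_graph V H"
    and H: "{a, b, c} \<in> H" "{a, b, d} \<in> H" "{c, d, e} \<in> H"
  shows "\<not> distinct [a, b, c, d, e]"
proof
  assume dist: "distinct [a, b, c, d, e]"
  define f :: "nat \<Rightarrow> _" where "f = (!) [a, b, c, d, e]"
  define E where "E = {{a, b, c}, {a, b, d}, {c, d, e}}"
  have f: "f 0 = a" "f 1 = b" "f 2 = c" "f 3 = d" "f 4 = e" by (simp_all add: f_def eval_nat_numeral)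
  have "bij_betw f F5_verts {a, b, c, d, e}"
    using dist f unfolding bij_betw_def inj_on_def F5_verts_def by auto
  moreover have "(`) f ` F5_edges = E" using f by (simp add: F5_edges_def E_def)
  ultimately have "isomorphic F5_verts F5_edges {a, b, c, d, e} E"
    unfolding isomorphic_def by blast
  moreover have "subgraph {a, b, c, d, e} E V H"
    using H assms(2) dist unfolding subgraph_def three_graph_def E_def by auto
  ultimately show False using assms(1) unfolding F5_free_def by blast
qed

definition edge_triple :: "'a set set \<Rightarrow> 'a \<Rightarrow> 'a \<Rightarrow> 'a \<Rightarrow> bool" where
  "edge_triple H x y z \<longleftrightarrow> {x, y, z} \<in> H \<and> distinct [x, y, z]"

text \<open>Each edge through \<open>v\<close> contributes its two other vertices in both orders,
  which turns the degree constant 4/45 into 8/45.\<close>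

lemma card_link_edge_triple:
  assumes "three_graph V H"
  shows "card (link (edge_triple H) v) = 2 * degree H v"
proof -
  define S where "S = {e \<in> H. v \<in> e}"
  define P where "P = (\<lambda>e. {(x, y). e = {v, x, y} \<and> distinct [v, x, y]})"
  have "finite V" using assms by (simp add: three_graph_def)
  moreover have "S \<subseteq> Pow V" using assms by (auto simp: S_def three_graph_def)
  ultimately have "finite S" by (meson finite_Pow_iff finite_subset)
  have P2: "card (P e) = 2" if "e \<in> S" for e
  proof -
    have "card e = 3" "v \<in> e" using that assms by (auto simp: S_def three_graph_def)
    then have "card (e - {v}) = 2" by simp
    then obtain x y where xy: "e - {v} = {x, y}" "x \<noteq> y" by (auto simp: card_2_iff)
    then have e: "e = {v, x, y}" "v \<noteq> x" "v \<noteq> y" using \<open>v \<in> e\<close> by auto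
    have "P e = {(x, y), (y, x)}"
      using e xy(2) unfolding P_def by (auto simp: doubleton_eq_iff insert_eq_iff)
    then show ?thesis using xy(2) by simp
  qed
  have "link (edge_triple H) v = (\<Union>e\<in>S. P e)"
    by (auto simp: link_def edge_triple_def S_def P_def)
  then have "card (link (edge_triple H) v) = (\<Sum>e\<in>S. card (P e))"
    using \<open>finite S\<close> P2
    by (simp only:) (rule card_UN_disjoint, auto simp: P_def intro!: card_ge_0_finite)
  also have "\<dots> = 2 * card S" using P2 by simp
  finally show ?thesis by (simp add: degree_def S_def)
qed

theorem theorem1p1:
  fixes n :: nat and V :: "'a set" and H :: "'a set set"
  assumes "n \<ge> 5000"
    and "three_graph V H"
    and "card V = n"
    and "F5_free V H"
    and "real (min_degree V H) > 4 * (real n)\<^sup>2 / 45"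
  shows "three_partite V H"
proof -
  have fin: "finite V" and H: "\<And>e. e \<in> H \<Longrightarrow> e \<subseteq> V \<and> card e = 3"
    using assms(2) by (auto simp: three_graph_def)
  have "V \<noteq> {}" using assms(1,3) by auto
  interpret F5_free_triples V "edge_triple H" n
  proof
    show "finite V" "card V = n" "5000 \<le> n" by (fact fin assms)+
    show "edge_triple H y x z" if "edge_triple H x y z" for x y z
      using that by (auto simp: edge_triple_def insert_commute)
    show "edge_triple H y z x" if "edge_triple H x y z" for x y z
      using that by (auto simp: edge_triple_def insert_commute)
    show "x \<in> V" if "edge_triple H x y z" for x y z
      using that H by (auto simp: edge_triple_def)
    show "x \<noteq> y" if "edge_triple H x y z" for x y z
      using that by (simp add: edge_triple_def)
    show "e = a \<or> e = b"
      if "edge_triple H a b c" "edge_triple H a b d" "edge_triple H c d e" for a b c d e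
      using F5_free_edges[OF assms(4,2), of a b c d e] that by (auto simp: edge_triple_def)
    show "8 / 45 * (real n)\<^sup>2 < real (card (link (edge_triple H) v))" if "v \<in> V" for v
    proof -
      have "min_degree V H \<le> degree H v"
        unfolding min_degree_def using fin that by (intro Min_le) auto
      then have "real (min_degree V H) \<le> real (degree H v)" by (simp only: of_nat_le_iff)
      then show ?thesis using assms(5) by (simp add: card_link_edge_triple[OF assms(2)])
    qed
  qed
  obtain A B C where ABC: "A \<union> B \<union> C = V" "A \<inter> B = {}" "A \<inter> C = {}" "B \<inter> C = {}"
    and ind: "\<And>x y. adj x y \<Longrightarrow> \<not> {x, y} \<subseteq> A \<and> \<not> {x, y} \<subseteq> B \<and> \<not> {x, y} \<subseteq> C"
    using three_independent_classes[OF \<open>V \<noteq> {}\<close>] by blast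
  have "card (e \<inter> A) = 1 \<and> card (e \<inter> B) = 1 \<and> card (e \<inter> C) = 1" if e: "e \<in> H" for e
  proof -
    have fe: "finite e" "e \<subseteq> V" "card e = 3" using H[OF e] fin by (auto intro: finite_subset)
    obtain x y z where xyz: "e = {x, y, z}" "x \<noteq> y" "y \<noteq> z" "x \<noteq> z"
      using fe(3) by (auto simp: card_3_iff)
    then have "edge_triple H x y z" using e by (simp add: edge_triple_def)
    then have a: "adj x y" "adj x z" "adj y z" using T_adj by blast+
    have le: "card (e \<inter> X) \<le> 1" if "X \<in> {A, B, C}" for X
    proof -
      have "u = w" if "u \<in> e \<inter> X" "w \<in> e \<inter> X" for u w
        using that \<open>X \<in> {A, B, C}\<close> ind[OF a(1)] ind[OF a(2)] ind[OF a(3)] unfolding xyz(1) by auto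
      then show ?thesis using fe(1) by (simp add: card_le_Suc0_iff_eq)
    qed
    \<comment> \<open>Three vertices are covered by three parts that each contain at most one of
      them, so each part contains exactly one.\<close>
    have "e = (e \<inter> A) \<union> (e \<inter> B) \<union> (e \<inter> C)" using fe(2) ABC(1) by blast
    then have "3 = card ((e \<inter> A) \<union> (e \<inter> B) \<union> (e \<inter> C))" using fe(3) by simp
    also have "\<dots> \<le> card (e \<inter> A) + card (e \<inter> B) + card (e \<inter> C)"
      by (meson add_mono card_Un_le le_refl order_trans)
    finally show ?thesis using le[of A] le[of B] le[of C] by simp
  qed
  then show ?thesis unfolding three_partite_def using ABC by blast
qed

end
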